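(* There exist absolute constants $c>0$ and $p_0$ such that the following holds. Let $p>p_0$ be a prime and let $A\subset \mathbb{F}_p^*$ be a set with $2\le |A|<\sqrt{p}$. Then $$\max\bigl(|A\cdot A|,\;|A+A|\bigr)\;\geq\; c\,|A|^{1+\frac{1}{11}}\,\frac{1}{\log^{\frac{4}{11}}|A|}.$$
   Context: $\mathbb{F}_p$ is the field with $p$ elements ($p$ prime) and $\mathbb{F}_p^*$ is its multiplicative group. $A+A=\{a_1+a_2: a_1,a_2\in A\}$ and $A\cdot A=\{a_1a_2: a_1,a_2\in A\}$. $|\cdot|$ denotes cardinality, and $\log^{4/11}|A|$ means $(\log|A|)^{4/11}$. The constants are independent of $p$ and $A$. *)

theory Defs
  imports Complex_Main "HOL-Number_Theory.Residues" "HOL-Algebra.AbelCoset"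
begin

text \<open>
  The prime field with \<open>p\<close> elements is \<^term>\<open>residue_ring (int p)\<close>, and its multiplicative group
  is \<^term>\<open>Units (residue_ring (int p))\<close>; for prime \<open>p\<close> the locale \<^locale>\<open>residues_prime\<close> shows
  that the ring is a field. The type \<open>'a mod_ring\<close> is not used because the constants must be
  chosen before \<open>p\<close>. Sum and product sets are the library's \<^const>\<open>set_add\<close> and \<^const>\<open>set_mult\<close>.
\<close>

end

theory Submission
  imports Defs "HOL-Analysis.Harmonic_Numbers" "HOL-Analysis.Convex" "HOL-Library.Set_Algebras"
begin

text \<open>
  Let \<open>n = card A\<close>, let both \<open>card (A + A)\<close> and \<open>card (A * A)\<close> be at most \<open>K n\<close>, and (Pluennecke, after
  passing to half of \<open>A\<close>) let \<open>card (A + A + A + A)\<close> be \<open>O(K^3 n)\<close>. The multiplicative energy of \<open>A\<close>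
  is at least \<open>n^3 / K\<close>. Discarding the unpopular ratios yields a pivot \<open>x\<close> in \<open>A\<close> such that, for
  \<open>B\<^sub>2\<close> the set of \<open>b\<close> in \<open>A\<close> with \<open>card (b A \<inter> x A) \<ge> n / (4 K)\<close>, at least \<open>n^2 / (2 K)\<close> pairs
  \<open>(b, z)\<close> in \<open>B\<^sub>2 \<times> B\<^sub>2\<close> satisfy \<open>b z \<in> x A\<close>. Hence for some \<open>s\<close> the set \<open>B\<^sub>1\<close> of those \<open>b\<close> which
  have at least \<open>s\<close> such \<open>z\<close> satisfies \<open>s card B\<^sub>1 \<ge> n^2 / (2 K H)\<close>, with \<open>H\<close> the \<open>n\<close>-th harmonic number.

  If \<open>a, b\<close> are in \<open>B\<^sub>1\<close> and \<open>c, d\<close> in \<open>B\<^sub>2\<close>, most of \<open>a A\<close>, \<open>c A\<close> and \<open>- d A\<close> is covered by few translates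
  of \<open>- x A\<close>, whereas \<open>- b Z\<close> lies inside \<open>- x A\<close> for the set \<open>Z\<close> of \<open>z\<close> attached to \<open>b\<close>. So
  \<open>(c - d) U + (a - b) V\<close> is small for half of the elements \<open>U\<close> of \<open>B\<^sub>1\<close> and \<open>V\<close> of \<open>Z\<close>. Using \<open>Z\<close> in place
  of all of \<open>B\<^sub>2\<close> costs a factor \<open>K\<close> in the number of sums but saves a covering, worth \<open>K^2\<close>.

  Finally let \<open>R\<close> be the set of quotients \<open>(a - b) / (c - d)\<close>. Either some \<open>r\<close> in \<open>R\<close> has \<open>r + 1\<close> outside
  \<open>R\<close>, and then the sums \<open>u + (r + 1) v\<close> are pairwise distinct; or \<open>R\<close> is the whole field, and it
  contains some \<open>r\<close> for which the sums \<open>u + r v\<close> have few coincidences. Both cases bound \<open>n\<close> by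
  \<open>O(K^11 H^3)\<close>.
\<close>

section \<open>Averaging and Cauchy-Schwarz for finite sets\<close>

lemma ex_ge_average:
  fixes f :: "'i \<Rightarrow> nat"
  assumes "finite I" "I \<noteq> {}" "m \<le> (\<Sum>i\<in>I. f i)"
  obtains i where "i \<in> I" "m \<le> card I * f i"
proof -
  have "\<exists>i\<in>I. m \<le> card I * f i"
  proof (rule ccontr)
    assume "\<not> ?thesis"
    then have lt: "card I * f i < m" if "i \<in> I" for i
      using that by force
    have "card I * m \<le> (\<Sum>i\<in>I. card I * f i)"
      using assms(3) by (simp flip: sum_distrib_left)
    also have "\<dots> < (\<Sum>i\<in>I. m)"
      using assms lt by (intro sum_strict_mono) auto
    finally show False by simp
  qed
  then show ?thesis using that by blast
qed

text \<open>Cauchy-Schwarz over the fibres of \<open>f\<close>: their sizes add up to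
  \<open>card S\<close>, and the squares of their sizes add up to the number of colliding
  pairs.\<close>

lemma card_squared_le_collisions:
  assumes "finite S"
  shows "(card S)\<^sup>2 \<le> card (f ` S) * card {(u, v). u \<in> S \<and> v \<in> S \<and> f u = f v}"
proof -
  define fib where "fib y = {u \<in> S. f u = y}" for y
  have fin: "finite (fib y)" for y using assms by (simp add: fib_def)
  have "{(u, v). u \<in> S \<and> v \<in> S \<and> f u = f v} = (\<Union>y\<in>f ` S. fib y \<times> fib y)"
    by (auto simp: fib_def)
  also have "card \<dots> = (\<Sum>y\<in>f ` S. card (fib y \<times> fib y))"
    by (rule card_UN_disjoint) (use assms fin in \<open>auto simp: fib_def\<close>)
  finally have 1: "card {(u, v). u \<in> S \<and> v \<in> S \<and> f u = f v} = (\<Sum>y\<in>f ` S. (card (fib y))\<^sup>2)"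
    by (simp add: card_cartesian_product power2_eq_square)
  have "S = (\<Union>y\<in>f ` S. fib y)"
    by (auto simp: fib_def)
  then have "card S = card (\<Union>y\<in>f ` S. fib y)" by simp
  also have "\<dots> = (\<Sum>y\<in>f ` S. card (fib y))"
    by (rule card_UN_disjoint) (use assms fin in \<open>auto simp: fib_def\<close>)
  finally have 2: "card S = (\<Sum>y\<in>f ` S. card (fib y))" .
  have "real ((card S)\<^sup>2) \<le> real (card (f ` S) * card {(u, v). u \<in> S \<and> v \<in> S \<and> f u = f v})"
    unfolding 1 unfolding 2
    using sum_squared_le_sum_of_squares[of "\<lambda>y. real (card (fib y))" "f ` S"]
    by (simp add: mult.commute)
  then show ?thesis by (simp only: of_nat_le_iff)
qed

section \<open>Sumsets in abelian groups\<close>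

text \<open>
  Petridis's form of the Pluennecke inequality is usually proved for a subset minimising
  \<open>card (Z + S) / card Z\<close>, which may be tiny. Maximising the difference below instead
  yields the inequality Petridis's induction needs and forces \<open>Z\<close> to be large.
\<close>

lemma petridis:
  fixes X S :: "'a::ab_group_add set"
  assumes "finite X" "finite S"
  obtains Z where "Z \<subseteq> X" "card X \<le> 2 * card Z"
    "\<And>C. finite C \<Longrightarrow> card X * card (Z + S + C) \<le> 2 * card (X + S) * card (Z + C)"
proof (cases "X = {} \<or> S = {}")
  case True
  then have "card X * card (X + S + C) \<le> 2 * card (X + S) * card (X + C)" for C
    by auto
  then show ?thesis using that[of X] by auto
next
  case False
  define g where "g Z = 2 * int (card (X + S)) * int (card Z) - int (card X) * int (card (Z + S))" for Z
  have "\<exists>Z\<in>Pow X. \<forall>W\<in>Pow X. g W \<le> g Z"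
  proof -
    have "finite (g ` Pow X)" "g ` Pow X \<noteq> {}" using assms by auto
    then have "Max (g ` Pow X) \<in> g ` Pow X" "\<forall>W\<in>Pow X. g W \<le> Max (g ` Pow X)"
      by (auto intro: Max_in)
    then show ?thesis by (metis imageE)
  qed
  then obtain Z where Z: "Z \<subseteq> X" and max: "\<And>W. W \<subseteq> X \<Longrightarrow> g W \<le> g Z" by auto
  have finZ: "finite Z" using Z assms finite_subset by blast
  have finXS: "finite (X + S)" using assms by (simp add: finite_set_plus)
  have pos: "card (X + S) > 0"
    using False finXS by (auto simp: card_gt_0_iff set_plus_def)
  \<comment> \<open>Comparison with \<open>W = X\<close>, where
    \<open>g X = card (X + S) * card X\<close>, forces the maximiser to contain at least half of
    \<open>X\<close>; the factor 2 in \<open>g\<close> serves this purpose.\<close>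
  have "int (card (X + S)) * int (card X) \<le> 2 * int (card (X + S)) * int (card Z)"
    using max[of X] by (simp add: g_def algebra_simps) (smt (verit) mult_nonneg_nonneg of_nat_0_le_iff)
  then have "card (X + S) * card X \<le> card (X + S) * (2 * card Z)"
    by (metis (no_types, lifting) mult.assoc mult.left_commute of_nat_le_iff of_nat_mult of_nat_numeral)
  then have large: "card X \<le> 2 * card Z"
    using pos by simp
  have "card X * card (Z + S + C) \<le> 2 * card (X + S) * card (Z + C)" if "finite C" for C
    using that
  proof (induction C)
    case empty
    then show ?case by simp
  next
    case (insert c C)
    \<comment> \<open>Adding \<open>c\<close> to \<open>C\<close> brings into \<open>Z + C\<close>
      only the sums \<open>z + c\<close> with \<open>z\<close> outside \<open>N\<close>. For
      \<open>n\<close> in \<open>N\<close> every \<open>n + s + c\<close> already lies in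
      \<open>Z + S + C\<close>, so \<open>N + S\<close> yields nothing new there.\<close>
    define N where "N = {z \<in> Z. z + c \<in> Z + C}"
    have N: "N \<subseteq> Z" by (auto simp: N_def)
    have finN: "finite N" using N finZ finite_subset by blast
    have e1: "Z + insert c C = (Z + C) \<union> (\<lambda>z. z + c) ` (Z - N)"
      by (auto simp: set_plus_def N_def)
    have c1: "card (Z + insert c C) = card (Z + C) + (card Z - card N)"
      unfolding e1
      by (subst card_Un_disjoint)
        (use finZ insert.hyps in \<open>auto simp: finite_set_plus card_image N_def card_Diff_subset[OF finN N, unfolded N_def]\<close>)
    have "Z + S + insert c C \<subseteq> (Z + S + C) \<union> (\<lambda>z. z + c) ` ((Z + S) - (N + S))"
    proof
      fix x assume "x \<in> Z + S + insert c C"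
      then obtain y d where x: "x = y + d" "y \<in> Z + S" "d = c \<or> d \<in> C"
        by (auto simp: set_plus_def)
      show "x \<in> (Z + S + C) \<union> (\<lambda>z. z + c) ` ((Z + S) - (N + S))"
      proof (cases "d \<in> C")
        case True then show ?thesis using x by auto
      next
        case False
        then have d: "d = c" using x by auto
        show ?thesis
        proof (cases "y \<in> N + S")
          case True
          then obtain n s where ns: "y = n + s" "n \<in> N" "s \<in> S" by (auto simp: set_plus_def)
          then have "n + c \<in> Z + C" by (auto simp: N_def)
          then have "(n + c) + s \<in> Z + C + S" using ns by auto
          moreover have "Z + C + S = Z + S + C" by (simp add: ac_simps)
          ultimately show ?thesis using x d ns by (simp add: ac_simps)
        next
          case False
          then show ?thesis using x d by auto
        qed
      qed
    qed
    then have "card (Z + S + insert c C) \<le> card ((Z + S + C) \<union> (\<lambda>z. z + c) ` ((Z + S) - (N + S)))"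
      using finZ insert.hyps assms by (intro card_mono) (auto simp: finite_set_plus)
    also have "\<dots> \<le> card (Z + S + C) + card ((\<lambda>z. z + c) ` ((Z + S) - (N + S)))"
      by (rule card_Un_le)
    also have "card ((\<lambda>z. z + c) ` ((Z + S) - (N + S))) = card (Z + S) - card (N + S)"
      using N finN assms
      by (subst card_image) (auto simp: card_Diff_subset finite_set_plus set_plus_mono2)
    finally have c2: "card (Z + S + insert c C) \<le> card (Z + S + C) + (card (Z + S) - card (N + S))" .
    have "N + S \<subseteq> Z + S" using N by (auto simp: set_plus_def)
    then have le: "card N \<le> card Z" "card (N + S) \<le> card (Z + S)"
      using N finZ assms by (auto intro!: card_mono simp: finite_set_plus)
    \<comment> \<open>Maximality against \<open>N\<close>: the part of \<open>Z + S\<close> outside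
      \<open>N + S\<close> is at most \<open>2 * card (X + S) / card X\<close> times the part of
      \<open>Z\<close> outside \<open>N\<close>, the ratio wanted for the increments in
      \<open>c2\<close> and \<open>c1\<close>.\<close>
    have "int (card X) * int (card (Z + S) - card (N + S)) \<le> 2 * int (card (X + S)) * int (card Z - card N)"
      using max[of N] N Z le by (simp add: g_def of_nat_diff algebra_simps)
    then have "card X * (card (Z + S) - card (N + S)) \<le> 2 * card (X + S) * (card Z - card N)"
      by (metis (no_types, lifting) of_nat_le_iff of_nat_mult of_nat_numeral)
    moreover have "card X * card (Z + S + insert c C) \<le>
        card X * card (Z + S + C) + card X * (card (Z + S) - card (N + S))"
      using mult_le_mono2[OF c2, of "card X"] by (simp add: distrib_left)
    ultimately show ?case
      using insert.IH unfolding c1 by (simp add: distrib_left)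
  qed
  then show ?thesis using that Z large by blast
qed

section \<open>Popular translates and coverings\<close>

text \<open>A pair \<open>(x, u)\<close> with sum \<open>t\<close> puts \<open>x\<close> into the
  intersection of \<open>X\<close> with \<open>t - T\<close>; averaging over \<open>t\<close> in
  \<open>X + T\<close> finds a large intersection.\<close>

lemma popular_reflection:
  fixes X T :: "'a::ab_group_add set"
  assumes "finite X" "finite T" "X \<noteq> {}" "T \<noteq> {}"
  obtains t where "card X * card T \<le> card (X + T) * card (X \<inter> (\<lambda>u. t - u) ` T)"
proof -
  have fin: "finite (X + T)" using assms by (simp add: finite_set_plus)
  have "card (X \<times> T) \<le> card (SIGMA t:X + T. X \<inter> (\<lambda>u. t - u) ` T)"
  proof (rule card_inj_on_le)
    show "inj_on (\<lambda>(x, u). (x + u, x)) (X \<times> T)" by (auto simp: inj_on_def)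
    show "(\<lambda>(x, u). (x + u, x)) ` (X \<times> T) \<subseteq> (SIGMA t:X + T. X \<inter> (\<lambda>u. t - u) ` T)"
      by (auto simp: set_plus_def image_iff intro!: bexI)
  qed (use assms fin in auto)
  also have "\<dots> = (\<Sum>t\<in>X + T. card (X \<inter> (\<lambda>u. t - u) ` T))"
    using assms fin by simp
  finally have "card X * card T \<le> (\<Sum>t\<in>X + T. card (X \<inter> (\<lambda>u. t - u) ` T))"
    by (simp add: card_cartesian_product)
  then show ?thesis
    using ex_ge_average[of "X + T" "card X * card T"] fin assms that
    by (metis (no_types, lifting) all_not_in_conv set_plus_intro)
qed

text \<open>
  A small sumset \<open>X + T\<close> also makes \<open>X\<close> concentrate on a translate of \<open>T\<close> itself, because
  \<open>x + u = x' + u'\<close> and \<open>x - u' = x' - u\<close> have the same number of solutions.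
\<close>

lemma popular_translate:
  fixes X T :: "'a::ab_group_add set"
  assumes "finite X" "finite T" "X \<noteq> {}" "T \<noteq> {}"
  obtains t where "card X * card T \<le> card (X + T) * card (X \<inter> (\<lambda>u. t + u) ` T)"
proof -
  let ?f = "\<lambda>(x, u). x + u :: 'a"
  let ?Q = "{(p, q). p \<in> X \<times> T \<and> q \<in> X \<times> T \<and> ?f p = ?f q}"
  let ?S = "SIGMA p:X \<times> T. X \<inter> (\<lambda>u. (fst p - snd p) + u) ` T"
  have img: "?f ` (X \<times> T) = X + T" by (simp add: set_plus_image)
  \<comment> \<open>A collision \<open>x + u = x' + u'\<close> reads
    \<open>x' = (x - u') + u\<close>, so the translation, given by \<open>(x, u')\<close>, and the
    point \<open>x'\<close> determine it.\<close>
  have "card ?Q \<le> card ?S"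
  proof (rule card_inj_on_le)
    show "inj_on (\<lambda>((x, u), (x', u')). ((x, u'), x')) ?Q"
      by (clarsimp simp: inj_on_def) (metis add_left_cancel)
    show "(\<lambda>((x, u), (x', u')). ((x, u'), x')) ` ?Q \<subseteq> ?S"
    proof clarsimp
      fix x u x' u' assume "x + u = x' + u'" "u \<in> T"
      then have "x' = x - u' + u" by (simp add: algebra_simps)
      then show "x' \<in> (+) (x - u') ` T" using \<open>u \<in> T\<close> by blast
    qed
  qed (use assms in auto)
  also have "\<dots> = (\<Sum>p\<in>X \<times> T. card (X \<inter> (\<lambda>u. (fst p - snd p) + u) ` T))"
    using assms by simp
  finally obtain p where "p \<in> X \<times> T"
    and p: "card ?Q \<le> card (X \<times> T) * card (X \<inter> (\<lambda>u. (fst p - snd p) + u) ` T)"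
    using ex_ge_average[of "X \<times> T"] assms
    by (metis (no_types, lifting) finite_SigmaI Sigma_empty_iff empty_iff ex_in_conv)
  have "(card (X \<times> T))\<^sup>2 \<le> card (X + T) * card ?Q"
    using card_squared_le_collisions[of "X \<times> T" ?f] assms img by simp
  also have "\<dots> \<le> card (X + T) * (card (X \<times> T) * card (X \<inter> (\<lambda>u. (fst p - snd p) + u) ` T))"
    using p by simp
  finally have "card (X \<times> T) * card (X \<times> T) \<le>
      card (X \<times> T) * (card (X + T) * card (X \<inter> (\<lambda>u. (fst p - snd p) + u) ` T))"
    by (simp add: power2_eq_square ac_simps)
  moreover have "card (X \<times> T) > 0" using assms by (simp add: card_gt_0_iff)
  ultimately have "card (X \<times> T) \<le> card (X + T) * card (X \<inter> (\<lambda>u. (fst p - snd p) + u) ` T)"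
    by simp
  then show ?thesis using that by (simp add: card_cartesian_product)
qed

text \<open>While more than a quarter of \<open>X\<close> is uncovered, the next translate of
  \<open>U\<close> captures at least \<open>card X / (4 * \<kappa>)\<close> new elements, so about
  \<open>3 * \<kappa>\<close> rounds cover three quarters.\<close>

lemma greedy_cover:
  fixes X U :: "'a::ab_group_add set" and \<kappa> :: real
  assumes "finite X" "X \<noteq> {}" and \<kappa>: "\<kappa> \<ge> 0"
    and pop: "\<And>W. W \<subseteq> X \<Longrightarrow> W \<noteq> {} \<Longrightarrow> \<exists>t. card W \<le> \<kappa> * card (W \<inter> (\<lambda>u. t + u) ` U)"
  obtains P W where "finite P" "W \<subseteq> X" "W \<subseteq> P + U" "3 * card X \<le> 4 * card W" "card P \<le> 4 * \<kappa>"
proof -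
  have "\<exists>P. finite P \<and> card P \<le> k \<and> (3 * card X \<le> 4 * card (X \<inter> (P + U)) \<or>
      k * card X \<le> 4 * \<kappa> * card (X \<inter> (P + U)))" for k :: nat
  proof (induction k)
    case 0
    then show ?case by (intro exI[of _ "{}"]) auto
  next
    case (Suc k)
    then obtain P where P: "finite P" "card P \<le> k" "3 * card X \<le> 4 * card (X \<inter> (P + U)) \<or>
      k * card X \<le> 4 * \<kappa> * card (X \<inter> (P + U))" by blast
    show ?case
    proof (cases "3 * card X \<le> 4 * card (X \<inter> (P + U))")
      case True
      then show ?thesis using P by (intro exI[of _ P]) auto
    next
      case False
      define W where "W = X - (P + U)"
      have split: "card X = card (X \<inter> (P + U)) + card W"
        unfolding W_def using assms(1) by (metis card_Int_Diff)
      have "W \<noteq> {}" using split False by (intro notI) simp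
      then obtain t where t: "card W \<le> \<kappa> * card (W \<inter> (\<lambda>u. t + u) ` U)"
        using pop[of W] by (auto simp: W_def)
      have sub: "(X \<inter> (P + U)) \<union> (W \<inter> (\<lambda>u. t + u) ` U) \<subseteq> X \<inter> (insert t P + U)"
        by (auto simp: W_def set_plus_def)
      have "card (X \<inter> (P + U)) + card (W \<inter> (\<lambda>u. t + u) ` U) =
          card ((X \<inter> (P + U)) \<union> (W \<inter> (\<lambda>u. t + u) ` U))"
        by (rule card_Un_disjoint[symmetric]) (use assms(1) in \<open>auto simp: W_def\<close>)
      also have "\<dots> \<le> card (X \<inter> (insert t P + U))"
        using sub assms(1) by (intro card_mono) auto
      finally have "real (card (X \<inter> (P + U))) + card (W \<inter> (\<lambda>u. t + u) ` U)
          \<le> card (X \<inter> (insert t P + U))"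
        by linarith
      from mult_left_mono[OF this \<kappa>]
      have "\<kappa> * card (X \<inter> (P + U)) + \<kappa> * card (W \<inter> (\<lambda>u. t + u) ` U)
          \<le> \<kappa> * card (X \<inter> (insert t P + U))"
        by (simp add: distrib_left)
      moreover have "real (card X) \<le> 4 * card W" using split False by simp
      moreover have "k * card X \<le> 4 * \<kappa> * card (X \<inter> (P + U))" using P False by simp
      ultimately have "Suc k * card X \<le> 4 * \<kappa> * card (X \<inter> (insert t P + U))"
        using t by (simp add: distrib_right)
      moreover have "card (insert t P) \<le> Suc k"
        using P by (simp add: card_insert_if)
      ultimately show ?thesis using P by (intro exI[of _ "insert t P"]) auto
    qed
  qed
  from this[of "nat \<lceil>3 * \<kappa>\<rceil>"] obtain P where P: "finite P" "card P \<le> nat \<lceil>3 * \<kappa>\<rceil>"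
    "3 * card X \<le> 4 * card (X \<inter> (P + U)) \<or> nat \<lceil>3 * \<kappa>\<rceil> * card X \<le> 4 * \<kappa> * card (X \<inter> (P + U))"
    by blast
  \<comment> \<open>Popularity of \<open>X\<close> itself gives \<open>\<kappa> \<ge> 1\<close>, so
    rounding \<open>3 * \<kappa>\<close> up does not exceed \<open>4 * \<kappa>\<close>.\<close>
  obtain t where "card X \<le> \<kappa> * card (X \<inter> (\<lambda>u. t + u) ` U)"
    using pop[of X] assms by blast
  also have "\<dots> \<le> \<kappa> * card X"
    using \<kappa> assms(1) by (intro mult_left_mono) (auto intro: card_mono)
  finally have \<kappa>1: "\<kappa> \<ge> 1" using assms by (simp add: card_gt_0_iff)
  have "3 * card X \<le> 4 * card (X \<inter> (P + U))"
  proof (rule ccontr)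
    assume *: "\<not> ?thesis"
    then have "nat \<lceil>3 * \<kappa>\<rceil> * card X \<le> 4 * \<kappa> * card (X \<inter> (P + U))" using P by blast
    moreover have "3 * \<kappa> * card X \<le> nat \<lceil>3 * \<kappa>\<rceil> * real (card X)"
      by (intro mult_right_mono) linarith+
    ultimately have "\<kappa> * (3 * card X) \<le> \<kappa> * (4 * card (X \<inter> (P + U)))" by simp
    then have "3 * card X \<le> 4 * card (X \<inter> (P + U))"
      using \<kappa>1 by (simp add: mult_le_cancel_left_pos flip: of_nat_le_iff)
    then show False using * by simp
  qed
  moreover have "card P \<le> 4 * \<kappa>" using P(2) \<kappa>1 by linarith
  ultimately show ?thesis using that[of P "X \<inter> (P + U)"] P by auto
qed

text \<open>For every nonempty part \<open>W\<close> of \<open>X\<close> the set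
  \<open>W + T\<close> lies in \<open>X + T\<close>, so \<open>popular_translate\<close> feeds
  \<open>greedy_cover\<close> with one ratio for all \<open>W\<close>.\<close>

lemma cover_by_translates:
  fixes X T :: "'a::ab_group_add set"
  assumes "finite X" "finite T" "X \<noteq> {}" "T \<noteq> {}"
  obtains P W where "finite P" "W \<subseteq> X" "W \<subseteq> P + T" "3 * card X \<le> 4 * card W"
    "card P \<le> 4 * (card (X + T) / card T)"
proof (rule greedy_cover[where X = X and U = T and \<kappa> = "card (X + T) / card T"])
  fix W assume W: "W \<subseteq> X" "W \<noteq> {}"
  then obtain t where t: "card W * card T \<le> card (W + T) * card (W \<inter> (\<lambda>u. t + u) ` T)"
    using popular_translate[of W T] assms finite_subset by metis
  also have "\<dots> \<le> card (X + T) * card (W \<inter> (\<lambda>u. t + u) ` T)"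
    using W assms by (intro mult_right_mono card_mono set_plus_mono2) (auto simp: finite_set_plus)
  finally have "real (card W) * card T \<le> card (X + T) * card (W \<inter> (\<lambda>u. t + u) ` T)"
    by (metis of_nat_le_iff of_nat_mult)
  moreover have "card T > 0" using assms by (simp add: card_gt_0_iff)
  ultimately show "\<exists>t. card W \<le> card (X + T) / card T * card (W \<inter> (\<lambda>u. t + u) ` T)"
    by (intro exI[of _ t]) (simp add: field_simps)
qed (use assms that in auto)

lemma cover_by_reflections:
  fixes X T :: "'a::ab_group_add set"
  assumes "finite X" "finite T" "X \<noteq> {}" "T \<noteq> {}"
  obtains P W where "finite P" "W \<subseteq> X" "W \<subseteq> P + uminus ` T" "3 * card X \<le> 4 * card W"
    "card P \<le> 4 * (card (X + T) / card T)"
proof (rule greedy_cover[where X = X and U = "uminus ` T" and \<kappa> = "card (X + T) / card T"])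
  fix W assume W: "W \<subseteq> X" "W \<noteq> {}"
  then obtain t where t: "card W * card T \<le> card (W + T) * card (W \<inter> (\<lambda>u. t - u) ` T)"
    using popular_reflection[of W T] assms finite_subset by metis
  also have "\<dots> \<le> card (X + T) * card (W \<inter> (\<lambda>u. t - u) ` T)"
    using W assms by (intro mult_right_mono card_mono set_plus_mono2) (auto simp: finite_set_plus)
  finally have "real (card W) * card T \<le> card (X + T) * card (W \<inter> (\<lambda>u. t - u) ` T)"
    by (metis of_nat_le_iff of_nat_mult)
  moreover have "card T > 0" using assms by (simp add: card_gt_0_iff)
  ultimately show "\<exists>t. card W \<le> card (X + T) / card T * card (W \<inter> (\<lambda>u. t + u) ` (uminus ` T))"
    by (intro exI[of _ t]) (simp add: field_simps image_image)
qed (use assms that in auto)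

section \<open>Sizes of sumsets, dilates and level sets\<close>

lemma card_set_plus_le:
  fixes S T :: "'a::plus set"
  assumes "finite S" "finite T"
  shows "card (S + T) \<le> card S * card T"
  unfolding set_plus_image
  using card_image_le[of "S \<times> T" "\<lambda>(x, y). x + y"] assms by (simp add: card_cartesian_product)

lemma image_mult_set_plus:
  fixes c :: "'a::semiring"
  shows "(*) c ` (S + T) = (*) c ` S + (*) c ` T"
  by (force simp: set_plus_def image_iff distrib_left)

text \<open>The sum of \<open>f\<close> is the sum over \<open>t\<close> of the level set sizes. If
  \<open>s\<close> maximises \<open>t\<close> times the size of the level set, each size is at most
  \<open>1 / t\<close> times that maximum, and the reciprocals add up to \<open>harm n\<close>. The
  logarithm originates here.\<close>

lemma popular_level:
  fixes f :: "'i \<Rightarrow> nat"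
  assumes "finite I" and "\<And>i. i \<in> I \<Longrightarrow> f i \<le> n" and "n \<ge> 1"
  obtains s where "s \<ge> 1" "real (\<Sum>i\<in>I. f i) \<le> harm n * (s * card {i \<in> I. s \<le> f i})"
proof -
  define g where "g s = real s * card {i \<in> I. s \<le> f i}" for s
  obtain s where s: "s \<in> {1..n}" and max: "\<And>t. t \<in> {1..n} \<Longrightarrow> g t \<le> g s"
  proof -
    have "finite (g ` {1..n})" "g ` {1..n} \<noteq> {}" using assms by auto
    then have "Max (g ` {1..n}) \<in> g ` {1..n}" "\<forall>t\<in>{1..n}. g t \<le> Max (g ` {1..n})"
      by (auto intro: Max_in)
    then show ?thesis using that by (metis imageE)
  qed
  have "f i = (\<Sum>t\<in>{1..n}. if t \<le> f i then 1 else 0)" if "i \<in> I" for i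
  proof -
    have "{t \<in> {1..n}. t \<le> f i} = {1..f i}" using assms(2)[OF that] by auto
    then show ?thesis by (simp flip: sum.inter_filter)
  qed
  then have "(\<Sum>i\<in>I. f i) = (\<Sum>i\<in>I. \<Sum>t\<in>{1..n}. if t \<le> f i then 1 else 0)"
    by (rule sum.cong[OF refl])
  also have "\<dots> = (\<Sum>t\<in>{1..n}. \<Sum>i\<in>I. if t \<le> f i then 1 else 0)"
    by (rule sum.swap)
  also have "\<dots> = (\<Sum>t\<in>{1..n}. card {i \<in> I. t \<le> f i})"
    using assms(1) by (simp flip: sum.inter_filter)
  finally have "real (\<Sum>i\<in>I. f i) = (\<Sum>t\<in>{1..n}. real (card {i \<in> I. t \<le> f i}))"
    by simp
  also have "\<dots> \<le> (\<Sum>t\<in>{1..n}. inverse (real t) * g s)"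
  proof (rule sum_mono)
    fix t assume t: "t \<in> {1..n}"
    then have "real (card {i \<in> I. t \<le> f i}) = inverse (real t) * g t"
      by (simp add: g_def)
    also have "\<dots> \<le> inverse (real t) * g s"
      using max[OF t] by (intro mult_left_mono) auto
    finally show "real (card {i \<in> I. t \<le> f i}) \<le> inverse (real t) * g s" .
  qed
  also have "\<dots> = harm n * g s"
    by (simp add: harm_def sum_distrib_right)
  finally have "real (\<Sum>i\<in>I. f i) \<le> harm n * (s * card {i \<in> I. s \<le> f i})"
    by (simp only: g_def of_nat_mult)
  then show ?thesis using that s by auto
qed

section \<open>Pivoting in a finite prime field\<close>

text \<open>
  The field is a subset of an ambient commutative ring, so that one type serves all primes;
  its unit \<open>e\<close> is an idempotent of that ring, in general different from \<open>1\<close>.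
\<close>

locale finite_prime_field =
  fixes F :: "'a::comm_ring_1 set" and e :: 'a
  assumes finite_F: "finite F"
    and unit_in: "e \<in> F"
    and unit_mult: "x \<in> F \<Longrightarrow> e * x = x"
    and diff_in: "x \<in> F \<Longrightarrow> y \<in> F \<Longrightarrow> x - y \<in> F"
    and mult_in: "x \<in> F \<Longrightarrow> y \<in> F \<Longrightarrow> x * y \<in> F"
    and no_zero_divisors: "x \<in> F \<Longrightarrow> y \<in> F \<Longrightarrow> x * y = 0 \<Longrightarrow> x = 0 \<or> y = 0"
    and multiples: "x \<in> F \<Longrightarrow> \<exists>k::nat. x = of_nat k * e"
begin

lemma zero_in: "0 \<in> F"
  using diff_in[OF unit_in unit_in] by simp

lemma add_in: "x \<in> F \<Longrightarrow> y \<in> F \<Longrightarrow> x + y \<in> F"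
  using diff_in[of x "0 - y"] diff_in[OF zero_in, of y] by simp

lemma cancel: "c \<in> F \<Longrightarrow> c \<noteq> 0 \<Longrightarrow> x \<in> F \<Longrightarrow> y \<in> F \<Longrightarrow> c * x = c * y \<Longrightarrow> x = y"
  using no_zero_divisors[of c "x - y"] diff_in[of x y] by (simp add: algebra_simps)

lemma inj_on_mult: "c \<in> F \<Longrightarrow> c \<noteq> 0 \<Longrightarrow> S \<subseteq> F \<Longrightarrow> inj_on ((*) c) S"
  by (meson cancel inj_onI subsetD)

lemma card_mult_image: "c \<in> F \<Longrightarrow> c \<noteq> 0 \<Longrightarrow> S \<subseteq> F \<Longrightarrow> card ((*) c ` S) = card S"
  by (simp add: card_image inj_on_mult)

section \<open>Small sumsets along a pivot\<close>

text \<open>With \<open>T\<close> the intersection of \<open>c A\<close> and \<open>x A\<close>, the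
  sumset \<open>c X + T\<close> lies in \<open>c (A + A)\<close>, so few reflections of
  \<open>T\<close> cover most of \<open>c X\<close>. After negating both sets, few translates of
  \<open>- T\<close> cover most of \<open>- c X\<close>. Both signs thus end up in translates of the
  same set \<open>- x A\<close>.\<close>

lemma dilate_cover:
  fixes N m :: real
  assumes A: "A \<subseteq> F" "0 \<notin> A" and X: "X \<subseteq> A" "X \<noteq> {}" and c: "c \<in> A"
    and N: "0 < N" "N \<le> card ((*) c ` A \<inter> (*) x ` A)" and m: "card (A + A) \<le> m"
  shows "\<exists>P W. finite P \<and> W \<subseteq> X \<and> (*) c ` W \<subseteq> P + (*) (- x) ` A \<and> 3 * card X \<le> 4 * card W \<and>
      card P \<le> 4 * (m / N)" (is ?pos)
    and "\<exists>P W. finite P \<and> W \<subseteq> X \<and> (*) (- c) ` W \<subseteq> P + (*) (- x) ` A \<and> 3 * card X \<le> 4 * card W \<and>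
      card P \<le> 4 * (m / N)" (is ?neg)
proof -
  define T where "T = (*) c ` A \<inter> (*) x ` A"
  have finA: "finite A" using A finite_F finite_subset by blast
  have finX: "finite X" using X finA finite_subset by blast
  have finT: "finite T" using finA by (simp add: T_def)
  have T: "T \<noteq> {}" "N \<le> card T" using N by (auto simp: T_def)
  have c': "c \<in> F" "c \<noteq> 0" "- c \<in> F" "- c \<noteq> 0"
    using c A diff_in[OF zero_in, of c] by auto
  have XF: "X \<subseteq> F" using X A by blast
  have bound: "4 * (k / card T) \<le> 4 * (m / N)" if "k \<le> card (A + A)" for k :: nat
  proof -
    have "k / card T \<le> m / N"
      using that m N T by (intro frac_le) auto
    then show ?thesis by simp
  qed
  have pull: "\<exists>W. W \<subseteq> X \<and> (*) g ` W = V \<and> card V \<le> card W" if "V \<subseteq> (*) g ` X" for g V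
  proof -
    from that obtain W where "W \<subseteq> X" "V = (*) g ` W" by (auto simp: subset_image_iff)
    moreover from this have "card ((*) g ` W) \<le> card W"
      using finX finite_subset by (intro card_image_le) blast
    ultimately show ?thesis by blast
  qed
  show ?pos
  proof -
    obtain P V where P: "finite P" "V \<subseteq> (*) c ` X" "V \<subseteq> P + uminus ` T"
      "3 * card ((*) c ` X) \<le> 4 * card V" "card P \<le> 4 * (card ((*) c ` X + T) / card T)"
      by (rule cover_by_reflections[of "(*) c ` X" T]) (use finX finT X T in auto)
    have "(*) c ` X + T \<subseteq> (*) c ` (A + A)"
      unfolding image_mult_set_plus using X by (intro set_plus_mono2) (auto simp: T_def)
    then have le: "card ((*) c ` X + T) \<le> card (A + A)"
      using finA by (meson card_image_le card_mono finite_imageI finite_set_plus le_trans)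
    have "card P \<le> 4 * (m / N)" using P(5) bound[OF le] by (rule order_trans)
    moreover obtain W where W: "W \<subseteq> X" "(*) c ` W = V" "card V \<le> card W"
      using pull[OF P(2)] by blast
    moreover have "3 * card X \<le> 4 * card W"
      using P(4) W(3) unfolding card_mult_image[OF c'(1,2) XF] by linarith
    moreover have "P + uminus ` T \<subseteq> P + (*) (- x) ` A"
      by (rule set_plus_mono2) (auto simp: T_def)
    then have "(*) c ` W \<subseteq> P + (*) (- x) ` A"
      unfolding W(2) using P(3) by (rule order_trans[rotated])
    ultimately show ?thesis using P(1) by blast
  qed
  show ?neg
  proof -
    obtain P V where P: "finite P" "V \<subseteq> (*) (- c) ` X" "V \<subseteq> P + uminus ` T"
      "3 * card ((*) (- c) ` X) \<le> 4 * card V"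
      "card P \<le> 4 * (card ((*) (- c) ` X + uminus ` T) / card (uminus ` T))"
      by (rule cover_by_translates[of "(*) (- c) ` X" "uminus ` T"]) (use finX finT X T in auto)
    have "(*) (- c) ` X + uminus ` T \<subseteq> (*) (- c) ` (A + A)"
      unfolding image_mult_set_plus using X by (intro set_plus_mono2) (auto simp: T_def)
    then have le: "card ((*) (- c) ` X + uminus ` T) \<le> card (A + A)"
      using finA by (meson card_image_le card_mono finite_imageI finite_set_plus le_trans)
    have "card (uminus ` T) = card T" by (simp add: card_image)
    with P(5) le have "card P \<le> 4 * (m / N)" using bound by (metis order_trans)
    moreover obtain W where W: "W \<subseteq> X" "(*) (- c) ` W = V" "card V \<le> card W"
      using pull[OF P(2)] by blast
    moreover have "3 * card X \<le> 4 * card W"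
      using P(4) W(3) unfolding card_mult_image[OF c'(3,4) XF] by linarith
    moreover have "P + uminus ` T \<subseteq> P + (*) (- x) ` A"
      by (rule set_plus_mono2) (auto simp: T_def)
    then have "(*) (- c) ` W \<subseteq> P + (*) (- x) ` A"
      unfolding W(2) using P(3) by (rule order_trans[rotated])
    ultimately show ?thesis using P(1) by blast
  qed
qed

text \<open>Write \<open>(c - d) u + (a - b) v\<close> as \<open>c u - d u + a v - b v\<close>. The
  first three terms lie in covers by translates of \<open>- x A\<close>, and \<open>- b v\<close>
  lies in \<open>- x A\<close> itself, so only three covering factors enter;
  \<open>64 = 4 ^ 3\<close>.\<close>

lemma pivot_sumset_bound:
  fixes N s m :: real
  assumes A: "A \<subseteq> F" "0 \<notin> A" and abcd: "a \<in> A" "c \<in> A" "d \<in> A"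
    and N: "0 < N" "N \<le> card ((*) c ` A \<inter> (*) x ` A)" "N \<le> card ((*) d ` A \<inter> (*) x ` A)"
    and s: "0 < s" "s \<le> card ((*) a ` A \<inter> (*) x ` A)"
    and m: "card (A + A) \<le> m"
    and X: "X \<subseteq> A" "X \<noteq> {}" and Z: "Z \<subseteq> A" "Z \<noteq> {}" "(*) b ` Z \<subseteq> (*) x ` A"
  obtains U V where "U \<subseteq> X" "V \<subseteq> Z" "card X \<le> 2 * card U" "card Z \<le> 2 * card V"
    "card ((*) (c - d) ` U + (*) (a - b) ` V) \<le> 64 * (m / N)\<^sup>2 * (m / s) * card (A + A + A + A)"
proof -
  have finA: "finite A" using A finite_F finite_subset by blast
  have fin: "finite X" "finite Z" using X Z finA finite_subset by blast+
  let ?B = "(*) (- x) ` A"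
  obtain P\<^sub>1 W\<^sub>1 where 1: "finite P\<^sub>1" "W\<^sub>1 \<subseteq> X" "(*) c ` W\<^sub>1 \<subseteq> P\<^sub>1 + ?B" "3 * card X \<le> 4 * card W\<^sub>1"
      "card P\<^sub>1 \<le> 4 * (m / N)"
    using dilate_cover(1)[OF A X abcd(2) N(1,2) m] by blast
  obtain P\<^sub>2 W\<^sub>2 where 2: "finite P\<^sub>2" "W\<^sub>2 \<subseteq> X" "(*) (- d) ` W\<^sub>2 \<subseteq> P\<^sub>2 + ?B" "3 * card X \<le> 4 * card W\<^sub>2"
      "card P\<^sub>2 \<le> 4 * (m / N)"
    using dilate_cover(2)[OF A X abcd(3) N(1,3) m] by blast
  obtain P\<^sub>3 V where 3: "finite P\<^sub>3" "V \<subseteq> Z" "(*) a ` V \<subseteq> P\<^sub>3 + ?B" "3 * card Z \<le> 4 * card V"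
      "card P\<^sub>3 \<le> 4 * (m / s)"
    using dilate_cover(1)[OF A Z(1,2) abcd(1) s m] by blast
  \<comment> \<open>Two subsets with three quarters of \<open>X\<close> each share at least half of
    it.\<close>
  define U where "U = W\<^sub>1 \<inter> W\<^sub>2"
  have "card (W\<^sub>1 \<union> W\<^sub>2) + card U = card W\<^sub>1 + card W\<^sub>2"
    unfolding U_def using 1 2 fin by (metis card_Un_Int finite_subset)
  moreover have "card (W\<^sub>1 \<union> W\<^sub>2) \<le> card X" using 1 2 fin by (intro card_mono) auto
  ultimately have U: "card X \<le> 2 * card U" using 1 2 by linarith
  have "(*) (c - d) ` U + (*) (a - b) ` V \<subseteq> (P\<^sub>1 + P\<^sub>2 + P\<^sub>3) + (?B + ?B + ?B + ?B)"
  proof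
    fix y assume "y \<in> (*) (c - d) ` U + (*) (a - b) ` V"
    then obtain u v where uv: "u \<in> U" "v \<in> V" "y = (c - d) * u + (a - b) * v"
      by (auto simp: set_plus_def)
    have "c * u \<in> P\<^sub>1 + ?B"
      using uv(1) by (intro subsetD[OF 1(3)] imageI) (simp add: U_def)
    moreover have "- d * u \<in> P\<^sub>2 + ?B"
      using uv(1) by (intro subsetD[OF 2(3)] imageI) (simp add: U_def)
    moreover have "a * v \<in> P\<^sub>3 + ?B"
      using uv(2) by (intro subsetD[OF 3(3)] imageI)
    moreover have "b * v \<in> (*) x ` A"
      using uv(2) 3(2) by (intro subsetD[OF Z(3)] imageI) blast
    then have "- b * v \<in> ?B" by auto
    ultimately have "(c * u + - d * u + a * v) + - b * v \<in> (P\<^sub>1 + ?B) + (P\<^sub>2 + ?B) + (P\<^sub>3 + ?B) + ?B"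
      by (intro set_plus_intro)
    moreover have "(c * u + - d * u + a * v) + - b * v = y"
      using uv by (simp add: algebra_simps)
    moreover have "(P\<^sub>1 + ?B) + (P\<^sub>2 + ?B) + (P\<^sub>3 + ?B) + ?B = (P\<^sub>1 + P\<^sub>2 + P\<^sub>3) + (?B + ?B + ?B + ?B)"
      by (simp only: ac_simps)
    ultimately show "y \<in> (P\<^sub>1 + P\<^sub>2 + P\<^sub>3) + (?B + ?B + ?B + ?B)" by simp
  qed
  then have "card ((*) (c - d) ` U + (*) (a - b) ` V) \<le> card ((P\<^sub>1 + P\<^sub>2 + P\<^sub>3) + (?B + ?B + ?B + ?B))"
    using 1(1) 2(1) 3(1) finA by (intro card_mono) (simp_all add: finite_set_plus)
  also have "\<dots> \<le> card (P\<^sub>1 + P\<^sub>2 + P\<^sub>3) * card (?B + ?B + ?B + ?B)"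
    using 1(1) 2(1) 3(1) finA by (intro card_set_plus_le) (simp_all add: finite_set_plus)
  also have "\<dots> \<le> (card P\<^sub>1 * card P\<^sub>2 * card P\<^sub>3) * card (A + A + A + A)"
  proof (rule mult_le_mono)
    have "card (P\<^sub>1 + P\<^sub>2 + P\<^sub>3) \<le> card (P\<^sub>1 + P\<^sub>2) * card P\<^sub>3"
      using 1(1) 2(1) 3(1) by (intro card_set_plus_le) (simp_all add: finite_set_plus)
    also have "\<dots> \<le> card P\<^sub>1 * card P\<^sub>2 * card P\<^sub>3"
      using 1(1) 2(1) by (intro mult_right_mono card_set_plus_le) auto
    finally show "card (P\<^sub>1 + P\<^sub>2 + P\<^sub>3) \<le> card P\<^sub>1 * card P\<^sub>2 * card P\<^sub>3" .
    show "card (?B + ?B + ?B + ?B) \<le> card (A + A + A + A)"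
      unfolding image_mult_set_plus[symmetric] using finA
      by (intro card_image_le) (auto simp: finite_set_plus)
  qed
  finally have "real (card ((*) (c - d) ` U + (*) (a - b) ` V)) \<le>
      (real (card P\<^sub>1) * real (card P\<^sub>2) * real (card P\<^sub>3)) * card (A + A + A + A)"
    by (metis of_nat_le_iff of_nat_mult)
  also have "\<dots> \<le> ((4 * (m / N)) * (4 * (m / N)) * (4 * (m / s))) * card (A + A + A + A)"
    using 1(5) 2(5) 3(5) N s m by (intro mult_right_mono mult_mono mult_nonneg_nonneg) auto
  also have "\<dots> = 64 * (m / N)\<^sup>2 * (m / s) * card (A + A + A + A)"
    by (simp add: power2_eq_square)
  finally show ?thesis
    using that[of U V] U 3(2,4) 1(2) by (simp add: U_def le_infI1)
qed

lemma card_multiplier_le: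
  assumes "A \<subseteq> F" "b \<in> F" "b \<noteq> 0"
  shows "card {z \<in> A. b * z \<in> (*) x ` A} \<le> card ((*) b ` A \<inter> (*) x ` A)"
proof (rule card_inj_on_le)
  show "inj_on ((*) b) {z \<in> A. b * z \<in> (*) x ` A}"
    using assms by (intro inj_on_mult) auto
  show "finite ((*) b ` A \<inter> (*) x ` A)"
    using assms finite_F finite_subset by blast
qed auto

text \<open>The level \<open>s\<close> serves twice: for \<open>b\<close> it makes the set
  \<open>Z\<close> with \<open>b Z\<close> inside \<open>x A\<close> large, and for \<open>a\<close>
  it bounds the intersection of \<open>a A\<close> and \<open>x A\<close> from below, hence the
  number of translates covering \<open>a V\<close> from above.\<close>

lemma pivot_halves:
  fixes N m :: real and s :: nat
  assumes A: "A \<subseteq> F" "0 \<notin> A"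
    and B: "B\<^sub>1 \<subseteq> B\<^sub>2" "B\<^sub>2 \<subseteq> A"
    and abcd: "a \<in> B\<^sub>1" "b \<in> B\<^sub>1" "c \<in> B\<^sub>2" "d \<in> B\<^sub>2" "c \<noteq> d"
    and N: "0 < N" "\<And>y. y \<in> B\<^sub>2 \<Longrightarrow> N \<le> card ((*) y ` A \<inter> (*) x ` A)"
    and s: "1 \<le> s" "\<And>y. y \<in> B\<^sub>1 \<Longrightarrow> s \<le> card {z \<in> B\<^sub>2. y * z \<in> (*) x ` A}"
    and m: "card (A + A) \<le> m"
  obtains U V where "U \<subseteq> B\<^sub>1" "V \<subseteq> B\<^sub>2" "card B\<^sub>1 \<le> 2 * card U" "s \<le> 2 * card V"
    "card ((*) (c - d) ` U + (*) (a - b) ` V) \<le> 64 * ((m / N)\<^sup>2 * (m / s) * card (A + A + A + A))"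
proof -
  define Z where "Z = {z \<in> B\<^sub>2. b * z \<in> (*) x ` A}"
  have finA: "finite A" using A finite_F finite_subset by blast
  have sub: "B\<^sub>1 \<subseteq> A" "Z \<subseteq> A" "Z \<subseteq> B\<^sub>2" "B\<^sub>1 \<subseteq> F" "B\<^sub>2 \<subseteq> F" using B A by (auto simp: Z_def)
  have sZ: "s \<le> card Z" using s(2)[OF abcd(2)] by (simp add: Z_def)
  then have "Z \<noteq> {}" using s(1) by auto
  have "a \<in> F" "a \<noteq> 0" using A B abcd by auto
  have "s \<le> card {z \<in> B\<^sub>2. a * z \<in> (*) x ` A}" using s abcd by blast
  also have "\<dots> \<le> card {z \<in> A. a * z \<in> (*) x ` A}"
    using B finA by (intro card_mono) auto
  also have "\<dots> \<le> card ((*) a ` A \<inter> (*) x ` A)"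
    using card_multiplier_le A \<open>a \<in> F\<close> \<open>a \<noteq> 0\<close> by blast
  finally have sa: "real s \<le> card ((*) a ` A \<inter> (*) x ` A)" by simp
  have mem: "a \<in> A" "c \<in> A" "d \<in> A" using abcd B by auto
  have "B\<^sub>1 \<noteq> {}" "(*) b ` Z \<subseteq> (*) x ` A" using abcd by (auto simp: Z_def)
  moreover have "0 < real s" using s(1) by simp
  ultimately obtain U V where UV: "U \<subseteq> B\<^sub>1" "V \<subseteq> Z" "card B\<^sub>1 \<le> 2 * card U" "card Z \<le> 2 * card V"
    and W: "card ((*) (c - d) ` U + (*) (a - b) ` V)
        \<le> 64 * (m / N)\<^sup>2 * (m / s) * card (A + A + A + A)"
    using pivot_sumset_bound[OF A mem N(1) N(2)[OF abcd(3)] N(2)[OF abcd(4)] _ sa m sub(1) _ sub(2) \<open>Z \<noteq> {}\<close>]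
    by metis
  show ?thesis
    by (rule that[of U V]) (use UV W sZ sub in \<open>auto simp: mult.assoc\<close>)
qed

text \<open>As \<open>r (c - d) = a - b\<close>, the sum
  \<open>(c - d) u + (c - d) v + (a - b) v\<close> is \<open>c - d\<close> times
  \<open>u + (r + e) v\<close>, and \<open>fresh\<close> makes these sums pairwise distinct.
  \<open>petridis\<close> removes the middle term for a factor \<open>2 * m / card U\<close>,
  leaving the sumset bounded by \<open>pivot_halves\<close>.\<close>

lemma sumset_bound_of_injective_pivot:
  fixes N m :: real and s :: nat
  assumes A: "A \<subseteq> F" "0 \<notin> A"
    and B: "B\<^sub>1 \<subseteq> B\<^sub>2" "B\<^sub>2 \<subseteq> A"
    and abcd: "a \<in> B\<^sub>1" "b \<in> B\<^sub>1" "c \<in> B\<^sub>2" "d \<in> B\<^sub>2" "c \<noteq> d"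
    and N: "0 < N" "\<And>y. y \<in> B\<^sub>2 \<Longrightarrow> N \<le> card ((*) y ` A \<inter> (*) x ` A)"
    and s: "1 \<le> s" "\<And>y. y \<in> B\<^sub>1 \<Longrightarrow> s \<le> card {z \<in> B\<^sub>2. y * z \<in> (*) x ` A}"
    and m: "card (A + A) \<le> m"
    and r: "r \<in> F" "r * (c - d) = a - b"
    and fresh: "\<And>y y' z z'. y \<in> B\<^sub>1 \<Longrightarrow> y' \<in> B\<^sub>1 \<Longrightarrow> z \<in> B\<^sub>2 \<Longrightarrow> z' \<in> B\<^sub>2 \<Longrightarrow>
      z \<noteq> z' \<Longrightarrow> (r + e) * (z - z') \<noteq> y - y'"
  shows "(real (card B\<^sub>1))\<^sup>2 * s \<le> 2048 * m * ((m / N)\<^sup>2 * (m / s) * card (A + A + A + A))"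
proof -
  obtain U V where UV: "U \<subseteq> B\<^sub>1" "V \<subseteq> B\<^sub>2" "card B\<^sub>1 \<le> 2 * card U" "s \<le> 2 * card V"
    and W: "card ((*) (c - d) ` U + (*) (a - b) ` V)
        \<le> 64 * ((m / N)\<^sup>2 * (m / s) * card (A + A + A + A))"
    by (rule pivot_halves[OF A B abcd N s m]) (assumption | rule that)+
  have finA: "finite A" using A finite_F finite_subset by blast
  have sub: "B\<^sub>1 \<subseteq> A" "B\<^sub>1 \<subseteq> F" "B\<^sub>2 \<subseteq> F" using A B by auto
  have finB: "finite B\<^sub>1" "finite B\<^sub>2" 
    using finite_subset[OF B(2) finA] finite_subset[OF B(1)] by auto
  have finUV: "finite U" "finite V"
    using finite_subset[OF UV(1) finB(1)] finite_subset[OF UV(2) finB(2)] by auto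
  have cd: "c - d \<in> F" "c - d \<noteq> 0" using abcd sub by (auto intro!: diff_in)
  have UF: "U \<subseteq> F" using UV sub by blast
  let ?X = "(*) (c - d) ` U" and ?S = "(*) (c - d) ` V" and ?T = "(*) (a - b) ` V"
  have cX: "card ?X = card U" using card_mult_image cd UF by blast
  obtain Z' where Z': "Z' \<subseteq> ?X" "card ?X \<le> 2 * card Z'"
    "\<And>C. finite C \<Longrightarrow> card ?X * card (Z' + ?S + C) \<le> 2 * card (?X + ?S) * card (Z' + C)"
    using petridis[of ?X ?S] finUV by auto
  have finZ': "finite Z'" using Z'(1) finUV finite_surj by blast
  have "card Z' * card V = card (Z' \<times> V)" by (simp add: card_cartesian_product)
  also have "\<dots> \<le> card (Z' + ?S + ?T)"
  proof (rule card_inj_on_le)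
    let ?g = "\<lambda>(z, v). z + (c - d) * v + (a - b) * v"
    show "?g ` (Z' \<times> V) \<subseteq> Z' + ?S + ?T" by (auto intro!: set_plus_intro)
    show "finite (Z' + ?S + ?T)" using finZ' finUV by (simp add: finite_set_plus)
    show "inj_on ?g (Z' \<times> V)"
    proof (rule inj_onI, clarify)
      fix z v z' v'
      assume h: "z \<in> Z'" "v \<in> V" "z' \<in> Z'" "v' \<in> V"
        and eq: "z + (c - d) * v + (a - b) * v = z' + (c - d) * v' + (a - b) * v'"
      obtain u u' where u: "u \<in> U" "z = (c - d) * u" "u' \<in> U" "z' = (c - d) * u'"
        using h Z' by blast
      have F: "u \<in> F" "u' \<in> F" "v \<in> F" "v' \<in> F" using u h UF UV sub by blast+
      have ee: "e * (v' - v) = v' - v" using F by (intro unit_mult diff_in)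
      have eq': "(c - d) * (u - u') = (c - d) * ((r + e) * (v' - v))"
      proof -
        have "(c - d) * ((r + e) * (v' - v)) = (r * (c - d)) * (v' - v) + (c - d) * (e * (v' - v))"
          by (simp add: algebra_simps)
        also have "\<dots> = (a - b) * (v' - v) + (c - d) * (v' - v)"
          by (simp only: r(2) ee)
        also have "\<dots> = (c - d) * (u - u')"
          using eq u by (simp add: algebra_simps)
        finally show ?thesis by simp
      qed
      have "u - u' \<in> F" "(r + e) * (v' - v) \<in> F"
        using F r(1) unit_in by (auto intro!: diff_in add_in mult_in)
      then have key: "u - u' = (r + e) * (v' - v)"
        by (rule cancel[OF cd _ _ eq'])
      have "v' = v"
      proof (rule ccontr)
        assume "v' \<noteq> v"
        then have "(r + e) * (v' - v) \<noteq> u - u'"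
          using u h UV sub by (intro fresh) auto
        then show False using key by simp
      qed
      then show "z = z' \<and> v = v'" using key u by simp
    qed
  qed
  finally have lower: "card Z' * card V \<le> card (Z' + ?S + ?T)" .
  have "?X + ?S \<subseteq> (*) (c - d) ` (A + A)"
    unfolding image_mult_set_plus using UV sub B by (intro set_plus_mono2) auto
  then have XS: "card (?X + ?S) \<le> card (A + A)"
    using finA by (meson card_image_le card_mono finite_imageI finite_set_plus le_trans)
  have ZT: "card (Z' + ?T) \<le> card (?X + ?T)"
    using Z'(1) finUV by (intro card_mono set_plus_mono2) (auto simp: finite_set_plus)
  define Q where "Q = (m / N)\<^sup>2 * (m / s) * card (A + A + A + A)"
  have m0: "0 \<le> m" using m by linarith
  have Q: "real (card (?X + ?T)) \<le> 64 * Q" using W by (simp add: Q_def)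
  have "card U * (card Z' * card V) \<le> 2 * card (A + A) * card (?X + ?T)"
  proof -
    have "card U * (card Z' * card V) \<le> card U * card (Z' + ?S + ?T)"
      using lower by simp
    also have "\<dots> \<le> 2 * card (?X + ?S) * card (Z' + ?T)"
      using Z'(3)[of ?T] finUV unfolding cX by simp
    also have "\<dots> \<le> 2 * card (A + A) * card (?X + ?T)"
      using XS ZT by (intro mult_le_mono) auto
    finally show ?thesis .
  qed
  then have "real (card U * (card Z' * card V)) \<le> real (2 * card (A + A) * card (?X + ?T))"
    by (simp only: of_nat_le_iff)
  then have up: "real (card U) * (real (card Z') * real (card V)) \<le> 2 * real (card (A + A)) * real (card (?X + ?T))"
    by simp
  \<comment> \<open>\<open>Z'\<close> has at least half the size of \<open>U\<close>, and
    \<open>U\<close> at least half that of \<open>B\<^sub>1\<close>, so the losses are 2, 4 and 2.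
    With the 2 of \<open>petridis\<close> and the 64 of the coverings they make 2048.\<close>
  have u1: "real (card B\<^sub>1) \<le> 2 * real (card U)" "real (card B\<^sub>1) \<le> 4 * real (card Z')" "real s \<le> 2 * real (card V)"
    using UV(3,4) Z'(2) unfolding cX by linarith+
  have "real (card B\<^sub>1) * (real (card B\<^sub>1) * real s) \<le>
      (2 * real (card U)) * ((4 * real (card Z')) * (2 * real (card V)))"
    using u1 by (intro mult_mono) auto
  also have "\<dots> = 16 * (real (card U) * (real (card Z') * real (card V)))" by simp
  also have "\<dots> \<le> 16 * (2 * real (card (A + A)) * real (card (?X + ?T)))"
    by (rule mult_left_mono[OF up]) simp
  also have "\<dots> \<le> 16 * (2 * m * (64 * Q))"
    using m Q m0 by (intro mult_left_mono mult_mono) auto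
  finally show ?thesis by (simp add: Q_def power2_eq_square)
qed

text \<open>Two distinct pairs coincide for at most one multiplier, so the sets of nontrivial
  coincidences are disjoint. By averaging, some nonzero multiplier has at most
  \<open>card B\<^sub>1 * card B\<^sub>2\<close> of them; the diagonal contributes as many
  again.\<close>

lemma few_collisions_multiplier:
  assumes B: "B\<^sub>1 \<subseteq> F" "B\<^sub>2 \<subseteq> F" "B\<^sub>1 \<noteq> {}" "B\<^sub>2 \<noteq> {}" and small: "card B\<^sub>1 * card B\<^sub>2 < card F"
  obtains \<xi> where "\<xi> \<in> F" "\<xi> \<noteq> 0"
    "card {(p, q). p \<in> B\<^sub>1 \<times> B\<^sub>2 \<and> q \<in> B\<^sub>1 \<times> B\<^sub>2 \<and> fst p + \<xi> * snd p = fst q + \<xi> * snd q}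
      \<le> 2 * (card B\<^sub>1 * card B\<^sub>2)"
proof -
  let ?P = "B\<^sub>1 \<times> B\<^sub>2"
  define M where "M \<xi> = {(p, q). p \<in> ?P \<and> q \<in> ?P \<and> p \<noteq> q \<and> fst p + \<xi> * snd p = fst q + \<xi> * snd q}" for \<xi>
  have finB: "finite B\<^sub>1" "finite B\<^sub>2" using B finite_F finite_subset by blast+
  have MP: "M \<xi> \<subseteq> ?P \<times> ?P" for \<xi> by (auto simp: M_def)
  have finM: "finite (M \<xi>)" for \<xi> using MP finB by (meson finite_SigmaI finite_subset)
  define k where "k = card B\<^sub>1 * card B\<^sub>2"
  have k: "k \<ge> 1" using finB B by (simp add: k_def Suc_le_eq card_gt_0_iff)
  have "\<exists>\<xi>\<in>F - {0}. card (M \<xi>) \<le> k"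
  proof (rule ccontr)
    assume "\<not> ?thesis"
    then have big: "k + 1 \<le> card (M \<xi>)" if "\<xi> \<in> F - {0}" for \<xi> using that by force
    have "M \<xi> \<inter> M \<xi>' = {}" if "\<xi> \<in> F - {0}" "\<xi>' \<in> F - {0}" "\<xi> \<noteq> \<xi>'" for \<xi> \<xi>'
    proof (rule ccontr)
      assume "M \<xi> \<inter> M \<xi>' \<noteq> {}"
      then obtain p q where "(p, q) \<in> M \<xi>" "(p, q) \<in> M \<xi>'" by (metis Int_iff ex_in_conv surj_pair)
      then obtain y z y' z' where h: "y \<in> B\<^sub>1" "z \<in> B\<^sub>2" "y' \<in> B\<^sub>1" "z' \<in> B\<^sub>2" "(y, z) \<noteq> (y', z')"
        "y + \<xi> * z = y' + \<xi> * z'" "y + \<xi>' * z = y' + \<xi>' * z'"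
        unfolding M_def by (cases p, cases q) force
      have "(\<xi> - \<xi>') * (z - z') = (y + \<xi> * z) - (y' + \<xi> * z') - ((y + \<xi>' * z) - (y' + \<xi>' * z'))"
        by (simp add: algebra_simps)
      then have "(\<xi> - \<xi>') * (z - z') = 0" using h by simp
      moreover have "\<xi> - \<xi>' \<in> F" "z - z' \<in> F"
        using that h B by (auto intro!: diff_in)
      ultimately have "z = z'" using no_zero_divisors[of "\<xi> - \<xi>'" "z - z'"] that(3) by auto
      then show False using h by simp
    qed
    then have "card (\<Union>\<xi>\<in>F - {0}. M \<xi>) = (\<Sum>\<xi>\<in>F - {0}. card (M \<xi>))"
      using finite_F finM by (intro card_UN_disjoint) auto
    moreover have "card (\<Union>\<xi>\<in>F - {0}. M \<xi>) \<le> card (?P \<times> ?P)"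
      using finB MP by (intro card_mono) auto
    moreover have "card (?P \<times> ?P) = k * k" by (simp add: card_cartesian_product k_def)
    moreover have "(\<Sum>\<xi>\<in>F - {0}. k + 1) \<le> (\<Sum>\<xi>\<in>F - {0}. card (M \<xi>))"
      using big by (intro sum_mono) auto
    ultimately have "card (F - {0}) * (k + 1) \<le> k * k" by simp
    \<comment> \<open>The strict inequality \<open>k < card F\<close> leaves at least
      \<open>k\<close> nonzero multipliers.\<close>
    moreover have "k * (k + 1) \<le> card (F - {0}) * (k + 1)"
      using small zero_in finite_F unfolding k_def
      by (intro mult_right_mono) (auto simp: card_Diff_singleton)
    ultimately have "k * (k + 1) \<le> k * k" by linarith
    then show False using k by simp
  qed
  then obtain \<xi> where \<xi>: "\<xi> \<in> F" "\<xi> \<noteq> 0" "card (M \<xi>) \<le> k" by blast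
  have "{(p, q). p \<in> ?P \<and> q \<in> ?P \<and> fst p + \<xi> * snd p = fst q + \<xi> * snd q} \<subseteq>
      (\<lambda>p. (p, p)) ` ?P \<union> M \<xi>"
    by (auto simp: M_def)
  then have "card {(p, q). p \<in> ?P \<and> q \<in> ?P \<and> fst p + \<xi> * snd p = fst q + \<xi> * snd q} \<le>
      card ((\<lambda>p. (p, p)) ` ?P \<union> M \<xi>)"
    using finB finM by (intro card_mono) auto
  also have "\<dots> \<le> card ((\<lambda>p. (p, p)) ` ?P) + card (M \<xi>)" by (rule card_Un_le)
  also have "card ((\<lambda>p. (p, p)) ` ?P) = k"
    by (subst card_image) (auto simp: inj_on_def card_cartesian_product k_def)
  finally show ?thesis using that \<xi> unfolding k_def by fastforce
qed

text \<open>Multiplication by \<open>c - d\<close> carries \<open>u + r v\<close> to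
  \<open>(c - d) u + (a - b) v\<close>, so \<open>spread\<close> limits the coincidences among the
  latter, and Cauchy-Schwarz bounds their number of values from below. One factor
  \<open>card B\<^sub>1\<close> cancels, and \<open>card B\<^sub>2\<close> is bounded by
  \<open>card A\<close>.\<close>

lemma sumset_bound_of_spread_pivot:
  fixes N m :: real and s :: nat
  assumes A: "A \<subseteq> F" "0 \<notin> A"
    and B: "B\<^sub>1 \<subseteq> B\<^sub>2" "B\<^sub>2 \<subseteq> A"
    and abcd: "a \<in> B\<^sub>1" "b \<in> B\<^sub>1" "c \<in> B\<^sub>2" "d \<in> B\<^sub>2" "c \<noteq> d"
    and N: "0 < N" "\<And>y. y \<in> B\<^sub>2 \<Longrightarrow> N \<le> card ((*) y ` A \<inter> (*) x ` A)"
    and s: "1 \<le> s" "\<And>y. y \<in> B\<^sub>1 \<Longrightarrow> s \<le> card {z \<in> B\<^sub>2. y * z \<in> (*) x ` A}"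
    and m: "card (A + A) \<le> m"
    and r: "r \<in> F" "r * (c - d) = a - b"
    and spread: "card {(p, q). p \<in> B\<^sub>1 \<times> B\<^sub>2 \<and> q \<in> B\<^sub>1 \<times> B\<^sub>2 \<and> fst p + r * snd p = fst q + r * snd q}
      \<le> 2 * (card B\<^sub>1 * card B\<^sub>2)"
  shows "real (card B\<^sub>1) * (real s)\<^sup>2
    \<le> 2048 * real (card A) * ((m / N)\<^sup>2 * (m / s) * card (A + A + A + A))"
proof -
  obtain U V where UV: "U \<subseteq> B\<^sub>1" "V \<subseteq> B\<^sub>2" "card B\<^sub>1 \<le> 2 * card U" "s \<le> 2 * card V"
    and W: "card ((*) (c - d) ` U + (*) (a - b) ` V)
        \<le> 64 * ((m / N)\<^sup>2 * (m / s) * card (A + A + A + A))"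
    by (rule pivot_halves[OF A B abcd N s m]) (assumption | rule that)+
  have finA: "finite A" using A finite_F finite_subset by blast
  have sub: "B\<^sub>1 \<subseteq> A" "B\<^sub>1 \<subseteq> F" "B\<^sub>2 \<subseteq> F" using A B by auto
  have finB: "finite B\<^sub>1" "finite B\<^sub>2" 
    using finite_subset[OF B(2) finA] finite_subset[OF B(1)] by auto
  have finUV: "finite U" "finite V"
    using finite_subset[OF UV(1) finB(1)] finite_subset[OF UV(2) finB(2)] by auto
  have cd: "c - d \<in> F" "c - d \<noteq> 0" using abcd sub by (auto intro!: diff_in)
  let ?T = "(*) (c - d) ` U + (*) (a - b) ` V"
  let ?f = "\<lambda>(u, v). (c - d) * u + (a - b) * v"
  let ?E = "{(p, q). p \<in> B\<^sub>1 \<times> B\<^sub>2 \<and> q \<in> B\<^sub>1 \<times> B\<^sub>2 \<and> fst p + r * snd p = fst q + r * snd q}"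
  have img: "?f ` (U \<times> V) \<subseteq> ?T" by (auto intro!: set_plus_intro)
  have finT: "finite ?T" using finUV by (simp add: finite_set_plus)
  have "{(p, q). p \<in> U \<times> V \<and> q \<in> U \<times> V \<and> ?f p = ?f q} \<subseteq> ?E"
  proof clarify
    fix u v u' v'
    assume h: "u \<in> U" "v \<in> V" "u' \<in> U" "v' \<in> V"
      and eq: "(c - d) * u + (a - b) * v = (c - d) * u' + (a - b) * v'"
    have F: "u \<in> F" "u' \<in> F" "v \<in> F" "v' \<in> F" using h UV sub by blast+
    have "(c - d) * (u + r * v) = (c - d) * u + (r * (c - d)) * v"
      by (simp add: algebra_simps)
    also have "\<dots> = (c - d) * u' + (r * (c - d)) * v'"
      using eq by (simp only: r(2))
    also have "\<dots> = (c - d) * (u' + r * v')"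
      by (simp add: algebra_simps)
    finally have eq': "(c - d) * (u + r * v) = (c - d) * (u' + r * v')" .
    have "u + r * v \<in> F" "u' + r * v' \<in> F"
      using F r(1) by (auto intro!: add_in mult_in)
    then have "u + r * v = u' + r * v'"
      by (rule cancel[OF cd _ _ eq'])
    then show "(u, v) \<in> B\<^sub>1 \<times> B\<^sub>2 \<and> (u', v') \<in> B\<^sub>1 \<times> B\<^sub>2 \<and>
        fst (u, v) + r * snd (u, v) = fst (u', v') + r * snd (u', v')"
      using h UV sub by auto
  qed
  moreover have "finite ?E"
    by (rule finite_subset[of _ "(B\<^sub>1 \<times> B\<^sub>2) \<times> (B\<^sub>1 \<times> B\<^sub>2)"]) (use finB in auto)
  ultimately have coll: "card {(p, q). p \<in> U \<times> V \<and> q \<in> U \<times> V \<and> ?f p = ?f q} \<le> 2 * (card B\<^sub>1 * card B\<^sub>2)"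
    by (intro order_trans[OF card_mono spread])
  have "(card (U \<times> V))\<^sup>2 \<le> card (?f ` (U \<times> V)) * card {(p, q). p \<in> U \<times> V \<and> q \<in> U \<times> V \<and> ?f p = ?f q}"
    using finUV by (intro card_squared_le_collisions) auto
  also have "\<dots> \<le> card ?T * (2 * (card B\<^sub>1 * card B\<^sub>2))"
    using coll card_mono[OF finT img] by (intro mult_le_mono)
  finally have "real ((card U * card V)\<^sup>2) \<le> real (card ?T * (2 * (card B\<^sub>1 * card B\<^sub>2)))"
    by (simp only: of_nat_le_iff card_cartesian_product)
  then have up: "(real (card U) * real (card V))\<^sup>2 \<le> real (card ?T) * (2 * (real (card B\<^sub>1) * real (card B\<^sub>2)))"
    by simp
  define Q where "Q = (m / N)\<^sup>2 * (m / s) * card (A + A + A + A)"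
  have Q: "real (card ?T) \<le> 64 * Q" using W by (simp add: Q_def)
  then have Q0: "0 \<le> Q" by (smt (verit) of_nat_0_le_iff)
  have u1: "real (card B\<^sub>1) \<le> 2 * real (card U)" "real s \<le> 2 * real (card V)"
    using UV(3,4) by linarith+
  have "real (card B\<^sub>1) * (real (card B\<^sub>1) * (real s)\<^sup>2) = (real (card B\<^sub>1) * real s)\<^sup>2"
    by (simp add: power2_eq_square)
  also have "\<dots> \<le> ((2 * real (card U)) * (2 * real (card V)))\<^sup>2"
    using u1 by (intro power_mono mult_mono) auto
  also have "\<dots> = 16 * (real (card U) * real (card V))\<^sup>2" by (simp add: power_mult_distrib)
  also have "\<dots> \<le> 16 * (real (card ?T) * (2 * (real (card B\<^sub>1) * real (card B\<^sub>2))))"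
    by (rule mult_left_mono[OF up]) simp
  also have "\<dots> \<le> 16 * ((64 * Q) * (2 * (real (card B\<^sub>1) * real (card A))))"
    using Q Q0 card_mono[OF finA B(2)] by (intro mult_left_mono mult_mono) auto
  also have "\<dots> = real (card B\<^sub>1) * (2048 * real (card A) * Q)" by simp
  finally have "real (card B\<^sub>1) * (real (card B\<^sub>1) * (real s)\<^sup>2) \<le> real (card B\<^sub>1) * (2048 * real (card A) * Q)" .
  moreover have "real (card B\<^sub>1) > 0" using abcd finB by (auto simp: card_gt_0_iff)
  ultimately show ?thesis unfolding Q_def by (simp only: mult_le_cancel_left_pos)
qed

section \<open>Choosing the pivot\<close>

text \<open>By Cauchy-Schwarz at least \<open>n ^ 4 / m\<close> triples \<open>(x, b, z)\<close>
  have \<open>b z\<close> in \<open>x A\<close>. Those with \<open>b\<close> or \<open>z\<close>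
  outside \<open>B x\<close> make up at most half of this bound; the rest is averaged over
  \<open>x\<close>.\<close>

lemma popular_pivot:
  fixes m :: real
  assumes A: "A \<subseteq> F" "0 \<notin> A" "A \<noteq> {}" and m: "card (A * A) \<le> m"
    and n: "n = real (card A)"
    and B: "B = (\<lambda>x. {b \<in> A. n\<^sup>2 / (4 * m) \<le> card ((*) b ` A \<inter> (*) x ` A)})"
  obtains x where "x \<in> A" "n ^ 3 / (2 * m) \<le> card {(b, z). b \<in> B x \<and> z \<in> B x \<and> b * z \<in> (*) x ` A}"
proof -
  have finA: "finite A" using A finite_F finite_subset by blast
  have n1: "n \<ge> 1" using A finA by (simp add: n Suc_le_eq card_gt_0_iff)
  have BA: "B x \<subseteq> A" for x by (auto simp: B)
  have finB: "finite (B x)" for x using finite_subset[OF BA finA] .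
  define N where "N = n\<^sup>2 / (4 * m)"
  define T where "T = (SIGMA x:A. {(b, z). b \<in> A \<and> z \<in> A \<and> b * z \<in> (*) x ` A})"
  define G where "G = (SIGMA x:A. {(b, z). b \<in> B x \<and> z \<in> B x \<and> b * z \<in> (*) x ` A})"
  \<comment> \<open>A pair \<open>(x, b)\<close> in \<open>L\<close> admits fewer than
    \<open>N\<close> values of \<open>z\<close>. Since \<open>b z = z b\<close>, the triples failing
    at \<open>z\<close> are a second image of \<open>L\<close> with coordinates swapped.\<close>
  define L where "L = (SIGMA p:{(x, b). x \<in> A \<and> b \<in> A \<and> b \<notin> B x}. {z \<in> A. snd p * z \<in> (*) (fst p) ` A})"
  have finT: "finite T"
    by (rule finite_subset[of _ "A \<times> A \<times> A"]) (use finA in \<open>auto simp: T_def\<close>)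
  have finL: "finite L"
    by (rule finite_subset[of _ "(A \<times> A) \<times> A"]) (use finA in \<open>auto simp: L_def\<close>)
  have finG: "finite G"
    by (rule finite_subset[OF _ finT]) (use BA in \<open>auto simp: T_def G_def\<close>)
  let ?Q = "{(p, q). p \<in> A \<times> A \<and> q \<in> A \<times> A \<and> (case p of (u, v) \<Rightarrow> u * v) = (case q of (u, v) \<Rightarrow> u * v)}"
  have "(card (A \<times> A))\<^sup>2 \<le> card ((\<lambda>(u, v). u * v) ` (A \<times> A)) * card ?Q"
    using finA by (intro card_squared_le_collisions) auto
  also have "(\<lambda>(u, v). u * v) ` (A \<times> A) = A * A" by (simp add: set_times_image)
  also have "card ?Q \<le> card T"
  proof (rule card_inj_on_le)
    let ?g = "\<lambda>((x, w), (b, z)). (x, b, z)"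
    show "inj_on ?g ?Q"
    proof (rule inj_onI)
      fix p q assume pq: "p \<in> ?Q" "q \<in> ?Q" "?g p = ?g q"
      then obtain x w w' b z where h: "p = ((x, w), (b, z))" "q = ((x, w'), (b, z))"
        by (cases p; cases q) auto
      then have "x * w = x * w'" "x \<in> A" "w \<in> A" "w' \<in> A" using pq(1,2) by auto
      then have "w = w'" using A by (metis cancel subsetD)
      then show "p = q" using h by simp
    qed
    show "?g ` ?Q \<subseteq> T" by (auto simp: T_def) (metis imageI)
  qed (rule finT)
  finally have "(card (A \<times> A))\<^sup>2 \<le> card (A * A) * card T" by simp
  then have "real ((card (A \<times> A))\<^sup>2) \<le> real (card (A * A) * card T)"
    by (simp only: of_nat_le_iff)
  then have "n ^ 4 \<le> real (card (A * A)) * card T"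
    by (simp add: n card_cartesian_product power_def numeral_eq_Suc)
  also have "\<dots> \<le> m * card T" using m by (intro mult_right_mono) auto
  finally have cT: "n ^ 4 \<le> m * card T" .
  have m0: "m > 0"
  proof (rule ccontr)
    assume "\<not> m > 0"
    then have "m * card T \<le> 0" by (simp add: mult_nonpos_nonneg)
    moreover have "n ^ 4 > 0" using n1 by simp
    ultimately show False using cT by linarith
  qed
  have cL: "card L \<le> n\<^sup>2 * N"
  proof -
    have fin: "finite {(x, b). x \<in> A \<and> b \<in> A \<and> b \<notin> B x}"
      by (rule finite_subset[of _ "A \<times> A"]) (use finA in auto)
    have "card L = (\<Sum>p\<in>{(x, b). x \<in> A \<and> b \<in> A \<and> b \<notin> B x}. card {z \<in> A. snd p * z \<in> (*) (fst p) ` A})"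
      unfolding L_def using fin finA by (intro card_SigmaI) auto
    then have "real (card L) = (\<Sum>p\<in>{(x, b). x \<in> A \<and> b \<in> A \<and> b \<notin> B x}. real (card {z \<in> A. snd p * z \<in> (*) (fst p) ` A}))"
      by simp
    also have "\<dots> \<le> (\<Sum>p\<in>{(x, b). x \<in> A \<and> b \<in> A \<and> b \<notin> B x}. N)"
    proof (rule sum_mono, clarify)
      fix x b assume h: "x \<in> A" "b \<in> A" "b \<notin> B x"
      then have "card {z \<in> A. b * z \<in> (*) x ` A} \<le> card ((*) b ` A \<inter> (*) x ` A)"
        using A by (intro card_multiplier_le) auto
      moreover have "card ((*) b ` A \<inter> (*) x ` A) < N" using h by (auto simp: B N_def)
      ultimately show "card {z \<in> A. snd (x, b) * z \<in> (*) (fst (x, b)) ` A} \<le> N" by simp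
    qed
    also have "\<dots> = card {(x, b). x \<in> A \<and> b \<in> A \<and> b \<notin> B x} * N" by simp
    also have "\<dots> \<le> card (A \<times> A) * N"
    proof (rule mult_right_mono)
      show "real (card {(x, b). x \<in> A \<and> b \<in> A \<and> b \<notin> B x}) \<le> card (A \<times> A)"
        unfolding of_nat_le_iff using finA by (intro card_mono) auto
    qed (use m0 in \<open>simp add: N_def\<close>)
    finally show ?thesis by (simp add: n card_cartesian_product power2_eq_square)
  qed
  have "T \<subseteq> G \<union> ((\<lambda>((x, b), z). (x, b, z)) ` L \<union> (\<lambda>((x, z), b). (x, b, z)) ` L)"
  proof
    fix t assume t: "t \<in> T"
    show "t \<in> G \<union> ((\<lambda>((x, b), z). (x, b, z)) ` L \<union> (\<lambda>((x, z), b). (x, b, z)) ` L)"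
    proof (rule ccontr)
      assume no: "\<not> ?thesis"
      obtain x b z where xbz: "t = (x, b, z)" by (cases t)
      have h: "x \<in> A" "b \<in> A" "z \<in> A" "b * z \<in> (*) x ` A"
        using t by (auto simp: T_def xbz)
      have "b \<in> B x \<and> z \<in> B x"
      proof (rule ccontr)
        assume "\<not> ?thesis"
        then have "((x, b), z) \<in> L \<or> ((x, z), b) \<in> L" using h by (auto simp: L_def mult.commute)
        then show False using no by (force simp: xbz)
      qed
      then show False using no h by (simp add: G_def xbz)
    qed
  qed
  then have "card T \<le> card (G \<union> ((\<lambda>((x, b), z). (x, b, z)) ` L \<union> (\<lambda>((x, z), b). (x, b, z)) ` L))"
    using finG finL by (intro card_mono) auto
  also have "\<dots> \<le> card G + (card L + card L)"
    by (intro order_trans[OF card_Un_le] add_mono card_image_le finL order_refl)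
  finally have "real (card T) \<le> card G + 2 * (n\<^sup>2 * N)" using cL by linarith
  then have "m * card T \<le> m * (card G + 2 * (n\<^sup>2 * N))" using m0 by (intro mult_left_mono) auto
  \<comment> \<open>The 4 in the threshold makes the two discarded families cost exactly half of
    \<open>n ^ 4\<close>.\<close>
  also have "\<dots> = m * card G + n ^ 4 / 2"
    using m0 by (simp add: N_def field_simps power2_eq_square power_def numeral_eq_Suc)
  finally have cG: "n ^ 4 \<le> 2 * (m * card G)" using cT by linarith
  have "finite {(b, z). b \<in> B x \<and> z \<in> B x \<and> b * z \<in> (*) x ` A}" for x
    by (rule finite_subset[of _ "B x \<times> B x"]) (use finB in auto)
  then have "card G = (\<Sum>x\<in>A. card {(b, z). b \<in> B x \<and> z \<in> B x \<and> b * z \<in> (*) x ` A})"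
    unfolding G_def using finA by (intro card_SigmaI) auto
  then obtain x where x: "x \<in> A"
    "card G \<le> card A * card {(b, z). b \<in> B x \<and> z \<in> B x \<and> b * z \<in> (*) x ` A}"
    by (rule ex_ge_average[OF finA A(3) eq_refl])
  then have "real (card G) \<le> real (card A * card {(b, z). b \<in> B x \<and> z \<in> B x \<and> b * z \<in> (*) x ` A})"
    by (simp only: of_nat_le_iff)
  then have le: "m * card G \<le> m * (n * card {(b, z). b \<in> B x \<and> z \<in> B x \<and> b * z \<in> (*) x ` A})"
    using m0 by (intro mult_left_mono) (auto simp: n)
  have "n * n ^ 3 = n ^ 4" by (simp add: power_def numeral_eq_Suc)
  also have "\<dots> \<le> 2 * (m * (n * card {(b, z). b \<in> B x \<and> z \<in> B x \<and> b * z \<in> (*) x ` A}))"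
    using cG le by linarith
  also have "\<dots> = n * (2 * m * card {(b, z). b \<in> B x \<and> z \<in> B x \<and> b * z \<in> (*) x ` A})" by simp
  finally have "n * n ^ 3 \<le> n * (2 * m * card {(b, z). b \<in> B x \<and> z \<in> B x \<and> b * z \<in> (*) x ` A})" .
  then have "n ^ 3 \<le> 2 * m * card {(b, z). b \<in> B x \<and> z \<in> B x \<and> b * z \<in> (*) x ` A}"
    using n1 by (simp only: mult_le_cancel_left_pos)
  then show ?thesis using that x(1) m0 by (simp add: field_simps)
qed

section \<open>Combining the cases\<close>

text \<open>The fourfold sumset stays a separate factor, since \<open>sum_product\<close> bounds it
  only for a suitable large subset.\<close>

lemma sum_product_bound:
  fixes m :: real
  assumes A: "A \<subseteq> F" "0 \<notin> A" "A \<noteq> {}" and small: "(card A)\<^sup>2 < card F"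
    and sum: "card (A + A) \<le> m" and prod: "card (A * A) \<le> m"
  shows "real (card A) ^ 10 \<le> 2 ^ 18 * harm (card A) ^ 3 * m ^ 8 * card (A + A + A + A)"
proof -
  define n where "n = real (card A)"
  define q where "q = real (card (A + A + A + A))"
  define H where "H = (harm (card A) :: real)"
  have finA: "finite A" using A finite_F finite_subset by blast
  have cA: "card A \<ge> 1" using A finA by (simp add: Suc_le_eq card_gt_0_iff)
  then have n1: "n \<ge> 1" by (simp add: n_def)
  have grow: "card S \<le> card (S + A)" if "finite S" for S
  proof -
    obtain y where "y \<in> A" using A by blast
    then have "(\<lambda>u. u + y) ` S \<subseteq> S + A" by auto
    then have "card ((\<lambda>u. u + y) ` S) \<le> card (S + A)"
      using that finA by (intro card_mono) (auto simp: finite_set_plus)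
    then show ?thesis by (simp add: card_image)
  qed
  have mn: "m \<ge> n" using grow[OF finA] sum by (simp add: n_def)
  have q1: "q \<ge> 1"
    using grow[of A] grow[of "A + A"] grow[of "A + A + A"] finA cA by (simp add: q_def finite_set_plus)
  have "H \<ge> harm 1" unfolding H_def using cA
    by (simp only: harm_mono)
  then have H1: "H \<ge> 1" by (simp add: harm_def)
  have m0: "m > 0" "n > 0" using mn n1 by auto
  define B where "B = (\<lambda>x. {b \<in> A. n\<^sup>2 / (4 * m) \<le> card ((*) b ` A \<inter> (*) x ` A)})"
  obtain x where x: "x \<in> A"
    and rich: "n ^ 3 / (2 * m) \<le> card {(b, z). b \<in> B x \<and> z \<in> B x \<and> b * z \<in> (*) x ` A}"
    by (rule popular_pivot[OF A prod n_def B_def])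
  define B\<^sub>2 where "B\<^sub>2 = B x"
  define f where "f b = card {z \<in> B\<^sub>2. b * z \<in> (*) x ` A}" for b
  have B2: "B\<^sub>2 \<subseteq> A" by (auto simp: B\<^sub>2_def B_def)
  have finB2: "finite B\<^sub>2" by (rule finite_subset[OF B2 finA])
  have "{(b, z). b \<in> B\<^sub>2 \<and> z \<in> B\<^sub>2 \<and> b * z \<in> (*) x ` A} = (SIGMA b:B\<^sub>2. {z \<in> B\<^sub>2. b * z \<in> (*) x ` A})"
    by auto
  then have pairs: "card {(b, z). b \<in> B\<^sub>2 \<and> z \<in> B\<^sub>2 \<and> b * z \<in> (*) x ` A} = (\<Sum>b\<in>B\<^sub>2. f b)"
    using finB2 by (simp add: f_def)
  have "f b \<le> card A" for b
    unfolding f_def using B2 finA by (intro card_mono) auto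
  then obtain s where s: "s \<ge> 1" "real (\<Sum>b\<in>B\<^sub>2. f b) \<le> H * (s * card {b \<in> B\<^sub>2. s \<le> f b})"
    unfolding H_def by (rule popular_level[OF finB2 _ cA])
  define B\<^sub>1 where "B\<^sub>1 = {b \<in> B\<^sub>2. s \<le> f b}"
  have B1: "B\<^sub>1 \<subseteq> B\<^sub>2" by (auto simp: B\<^sub>1_def)
  define k where "k = real (card B\<^sub>1)"
  have kn: "k \<le> n" unfolding k_def n_def using B1 B2 finA by (simp add: card_mono)
  have "n ^ 3 / (2 * m) \<le> H * (s * k)"
    using rich s(2) pairs by (simp add: B\<^sub>2_def[symmetric] B\<^sub>1_def[symmetric] k_def)
  then have level: "n ^ 3 \<le> 2 * m * H * (s * k)"
    using m0 by (simp add: field_simps)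
  have "k \<noteq> 0"
  proof
    assume "k = 0"
    then have "n ^ 3 \<le> 0" using level by simp
    then show False using n1 by (smt (verit) zero_less_power)
  qed
  then have k0: "k > 0" and "B\<^sub>1 \<noteq> {}" by (auto simp: k_def)
  have s0: "real s > 0" using s by simp
  define N where "N = n\<^sup>2 / (4 * m)"
  have N: "N > 0" "\<And>y. y \<in> B\<^sub>2 \<Longrightarrow> N \<le> card ((*) y ` A \<inter> (*) x ` A)"
    using m0 by (auto simp: N_def B\<^sub>2_def B_def)
  have sB: "s \<le> card {z \<in> B\<^sub>2. y * z \<in> (*) x ` A}" if "y \<in> B\<^sub>1" for y
    using that by (simp add: B\<^sub>1_def f_def)
  have W: "(m / N)\<^sup>2 * (m / s) * q = 16 * m ^ 5 * q / (n ^ 4 * s)"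
    using m0 s0 by (simp add: N_def field_simps power_def numeral_eq_Suc)
  have FB: "B\<^sub>1 \<subseteq> F" "B\<^sub>2 \<subseteq> F" using A B1 B2 by auto
  have "n ^ 10 \<le> 2 ^ 18 * H ^ 3 * m ^ 8 * q"
  proof (cases "\<exists>c\<in>B\<^sub>2. \<exists>d\<in>B\<^sub>2. c \<noteq> d")
    \<comment> \<open>Without two distinct elements in \<open>B\<^sub>2\<close> there is no
      denominator, but then at most one pair is counted by \<open>rich\<close>, so
      \<open>n ^ 3 \<le> 2 * m\<close>, and \<open>m \<ge> n\<close> supplies the other
      powers.\<close>
    case False
    obtain y where "y \<in> B\<^sub>1" using \<open>B\<^sub>1 \<noteq> {}\<close> by blast
    then have "B\<^sub>2 \<subseteq> {y}" using False B1 by blast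
    then have "{(b, z). b \<in> B\<^sub>2 \<and> z \<in> B\<^sub>2 \<and> b * z \<in> (*) x ` A} \<subseteq> {(y, y)}" by auto
    then have "card {(b, z). b \<in> B\<^sub>2 \<and> z \<in> B\<^sub>2 \<and> b * z \<in> (*) x ` A} \<le> card {(y, y)}"
      by (intro card_mono) auto
    then have "n ^ 3 / (2 * m) \<le> 1"
      using rich by (simp add: B\<^sub>2_def)
    then have "n ^ 3 \<le> 2 * m" using m0 by (simp add: field_simps)
    then have "n ^ 7 * n ^ 3 \<le> m ^ 7 * (2 * m)"
      using mn m0 by (intro mult_mono power_mono) auto
    then have "n ^ 10 \<le> 2 * m ^ 8" by (simp flip: power_add power_Suc2 add: mult.left_commute)
    also have "\<dots> \<le> (2 ^ 18 * H ^ 3 * q) * m ^ 8"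
    proof (rule mult_right_mono)
      have "H ^ 3 \<ge> 1" using H1 by simp
      then have "1 * 1 \<le> H ^ 3 * q" using q1 H1 by (intro mult_mono) auto
      moreover have "2 \<le> 2 ^ 18 * y" if "1 * 1 \<le> y" for y :: real using that by simp
      ultimately show "2 \<le> 2 ^ 18 * H ^ 3 * q" by (simp only: mult.assoc)
    qed (use m0 in simp)
    finally show ?thesis by (simp add: ac_simps)
  next
    case True
    then obtain c\<^sub>0 d\<^sub>0 where c0: "c\<^sub>0 \<in> B\<^sub>2" "d\<^sub>0 \<in> B\<^sub>2" "c\<^sub>0 \<noteq> d\<^sub>0" by blast
    define R where "R = {r \<in> F. \<exists>a\<in>B\<^sub>1. \<exists>b\<in>B\<^sub>1. \<exists>c\<in>B\<^sub>2. \<exists>d\<in>B\<^sub>2. c \<noteq> d \<and> r * (c - d) = a - b}"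
    show ?thesis
    proof (cases "\<exists>r\<in>R. r + e \<notin> R")
      case True
      then obtain r a b c d where r: "r \<in> F" "r * (c - d) = a - b" "r + e \<notin> R"
        and abcd: "a \<in> B\<^sub>1" "b \<in> B\<^sub>1" "c \<in> B\<^sub>2" "d \<in> B\<^sub>2" "c \<noteq> d"
        by (auto simp: R_def)
      have "r + e \<in> F" using r unit_in by (intro add_in)
      then have fresh: "(r + e) * (z - z') \<noteq> y - y'"
        if "y \<in> B\<^sub>1" "y' \<in> B\<^sub>1" "z \<in> B\<^sub>2" "z' \<in> B\<^sub>2" "z \<noteq> z'" for y y' z z'
        using r(3) that by (auto simp: R_def)
      have "k\<^sup>2 * s \<le> 2048 * m * ((m / N)\<^sup>2 * (m / s) * q)"
        unfolding k_def q_def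
        by (rule sumset_bound_of_injective_pivot[OF A(1,2) B1 B2 abcd N s(1) sB sum r(1,2) fresh])
      also have "\<dots> = 32768 * m ^ 6 * q / (n ^ 4 * s)"
        unfolding W by (simp add: power_def numeral_eq_Suc)
      finally have "(s * k)\<^sup>2 * n ^ 4 \<le> 32768 * m ^ 6 * q"
        using m0 s0 by (simp add: field_simps power2_eq_square)
      then have *: "4 * m\<^sup>2 * H\<^sup>2 * ((s * k)\<^sup>2 * n ^ 4) \<le> 4 * m\<^sup>2 * H\<^sup>2 * (32768 * m ^ 6 * q)"
        by (intro mult_left_mono) auto
      \<comment> \<open>Squaring \<open>level\<close> eliminates \<open>s * k\<close>. This gives
        only \<open>H\<^sup>2\<close>, which \<open>H \<ge> 1\<close> raises to the
        \<open>H ^ 3\<close> of the other case.\<close>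
      have "n ^ 10 = (n ^ 3)\<^sup>2 * n ^ 4" by (simp flip: power_mult power_add)
      also have "\<dots> \<le> (2 * m * H * (s * k))\<^sup>2 * n ^ 4"
        using level m0 by (intro mult_right_mono power_mono) auto
      also have "\<dots> = 4 * m\<^sup>2 * H\<^sup>2 * ((s * k)\<^sup>2 * n ^ 4)"
        by (simp add: power_mult_distrib)
      also note *
      also have "4 * m\<^sup>2 * H\<^sup>2 * (32768 * m ^ 6 * q) = (2 ^ 17 * H\<^sup>2) * (m ^ 8 * q)"
        by (simp add: power_def numeral_eq_Suc)
      also have "\<dots> \<le> (2 ^ 18 * H ^ 3) * (m ^ 8 * q)"
        using m0 q1 H1 by (intro mult_right_mono mult_mono power_increasing) auto
      finally show ?thesis by (simp add: mult.assoc)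
    next
      case False
      obtain y where y: "y \<in> B\<^sub>1" using \<open>B\<^sub>1 \<noteq> {}\<close> by blast
      \<comment> \<open>\<open>R\<close> contains 0 and is closed under adding the unit, so it
        contains every multiple of the unit; in a prime field that is every element.\<close>
      have "of_nat j * e \<in> R" for j
      proof (induction j)
        case 0
        have "(0::'a) * (c\<^sub>0 - d\<^sub>0) = y - y" by simp
        then have "0 \<in> R" unfolding R_def using y c0 zero_in by blast
        then show ?case by simp
      next
        case (Suc j)
        then have "of_nat j * e + e \<in> R" using False by blast
        then show ?case by (simp add: algebra_simps)
      qed
      then have FR: "F \<subseteq> R" using multiples by blast
      have "card B\<^sub>1 * card B\<^sub>2 \<le> card A * card A"
        using B1 B2 finA by (intro mult_le_mono card_mono) auto
      then have few: "card B\<^sub>1 * card B\<^sub>2 < card F" using small by (simp add: power2_eq_square)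
      have "B\<^sub>2 \<noteq> {}" using c0 by blast
      obtain \<xi> where \<xi>: "\<xi> \<in> F" "\<xi> \<noteq> 0" and spread:
        "card {(p, q). p \<in> B\<^sub>1 \<times> B\<^sub>2 \<and> q \<in> B\<^sub>1 \<times> B\<^sub>2 \<and> fst p + \<xi> * snd p = fst q + \<xi> * snd q}
          \<le> 2 * (card B\<^sub>1 * card B\<^sub>2)"
        by (rule few_collisions_multiplier[OF FB \<open>B\<^sub>1 \<noteq> {}\<close> \<open>B\<^sub>2 \<noteq> {}\<close> few])
      obtain a b c d where abcd: "a \<in> B\<^sub>1" "b \<in> B\<^sub>1" "c \<in> B\<^sub>2" "d \<in> B\<^sub>2" "c \<noteq> d"
        and r: "\<xi> * (c - d) = a - b"
        using subsetD[OF FR \<xi>(1)] unfolding R_def by blast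
      have "k * (real s)\<^sup>2 \<le> 2048 * n * ((m / N)\<^sup>2 * (m / s) * q)"
        unfolding k_def q_def n_def
        by (rule sumset_bound_of_spread_pivot[OF A(1,2) B1 B2 abcd N s(1) sB sum \<xi>(1) r spread])
      also have "\<dots> = 32768 * m ^ 5 * q / (n ^ 3 * s)"
        unfolding W using m0 s0 by (simp add: field_simps power_def numeral_eq_Suc)
      finally have b: "k * s ^ 3 * n ^ 3 \<le> 32768 * m ^ 5 * q"
        using m0 s0 by (simp add: field_simps power_def numeral_eq_Suc)
      \<comment> \<open>Since \<open>k \<le> n\<close>, the product \<open>k * s ^ 3\<close> can be
        completed to \<open>(s * k) ^ 3\<close>, which the cube of \<open>level\<close> then
        eliminates; hence \<open>H ^ 3\<close>.\<close>
      have "k\<^sup>2 \<le> n\<^sup>2" using kn k0 by (intro power_mono) auto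
      then have "k\<^sup>2 * (k * s ^ 3 * n ^ 3) \<le> n\<^sup>2 * (32768 * m ^ 5 * q)"
        by (rule mult_mono[OF _ b]) (use k0 m0 in auto)
      then have "n\<^sup>2 * ((s * k) ^ 3 * n) \<le> n\<^sup>2 * (32768 * m ^ 5 * q)"
        by (simp add: power_def numeral_eq_Suc ac_simps)
      then have "(s * k) ^ 3 * n \<le> 32768 * m ^ 5 * q"
        using m0 by simp
      then have *: "8 * m ^ 3 * H ^ 3 * ((s * k) ^ 3 * n) \<le> 8 * m ^ 3 * H ^ 3 * (32768 * m ^ 5 * q)"
        using m0 H1 by (intro mult_left_mono) auto
      have "n ^ 10 = (n ^ 3) ^ 3 * n" by (simp flip: power_mult power_Suc2)
      also have "\<dots> \<le> (2 * m * H * (s * k)) ^ 3 * n"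
        using level m0 by (intro mult_right_mono power_mono) auto
      also have "\<dots> = 8 * m ^ 3 * H ^ 3 * ((s * k) ^ 3 * n)"
        by (simp add: power_mult_distrib)
      also note *
      also have "8 * m ^ 3 * H ^ 3 * (32768 * m ^ 5 * q) = 2 ^ 18 * H ^ 3 * m ^ 8 * q"
        by (simp add: power_def numeral_eq_Suc)
      finally show ?thesis .
    qed
  qed
  then show ?thesis by (simp add: n_def H_def q_def)
qed

text \<open>\<open>petridis\<close> provides at least half of \<open>A\<close> as a set
  \<open>Z\<close> for which a summand \<open>A\<close> costs a factor \<open>2 * M / n\<close>. Two
  such steps bound the fourfold sumset of \<open>Z\<close>, and \<open>sum_product_bound\<close>
  applies to \<open>Z\<close>: the powers 8 and 3 of \<open>M\<close> add up to 11.\<close>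

lemma sum_product:
  assumes A: "A \<subseteq> F" "0 \<notin> A" "A \<noteq> {}" and small: "(card A)\<^sup>2 < card F"
  shows "real (card A) ^ 12 \<le> 2 ^ 30 * harm (card A) ^ 3 * real (max (card (A * A)) (card (A + A))) ^ 11"
proof -
  define n where "n = real (card A)"
  define M where "M = real (max (card (A * A)) (card (A + A)))"
  have finA: "finite A" using A finite_F finite_subset by blast
  have cA: "card A \<ge> 1" using A finA by (simp add: Suc_le_eq card_gt_0_iff)
  then have n1: "n \<ge> 1" by (simp add: n_def)
  obtain Z where Z: "Z \<subseteq> A" "card A \<le> 2 * card Z"
    and pl: "\<And>C. finite C \<Longrightarrow> card A * card (Z + A + C) \<le> 2 * card (A + A) * card (Z + C)"
    using petridis[OF finA finA] by blast
  have finZ: "finite Z" by (rule finite_subset[OF Z(1) finA])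
  have step: "n * card (Z + A + C) \<le> 2 * M * card (Z + C)" if "finite C" for C
  proof -
    have "real (card A * card (Z + A + C)) \<le> real (2 * card (A + A) * card (Z + C))"
      using pl[OF that] by (simp only: of_nat_le_iff)
    also have "\<dots> \<le> 2 * M * card (Z + C)"
      by (simp add: M_def mult_right_mono)
    finally show ?thesis by (simp add: n_def)
  qed
  have ZM: "card (Z + Z) \<le> M" "card (Z * Z) \<le> M" "card (Z + A) \<le> M"
  proof -
    have "Z + Z \<subseteq> A + A" "Z + A \<subseteq> A + A" "Z * Z \<subseteq> A * A"
      by (rule set_plus_mono2 set_times_mono2; use Z in simp)+
    then have "card (Z + Z) \<le> card (A + A)" "card (Z + A) \<le> card (A + A)" "card (Z * Z) \<le> card (A * A)"
      using finA by (simp_all add: card_mono finite_set_plus finite_set_times)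
    then show "card (Z + Z) \<le> M" "card (Z * Z) \<le> M" "card (Z + A) \<le> M"
      by (auto simp: M_def)
  qed
  have M0: "M \<ge> 0" by (simp add: M_def)
  have four: "n\<^sup>2 * card (Z + Z + Z + Z) \<le> 4 * M ^ 3"
  proof -
    have "card (Z + Z + Z + Z) \<le> card (Z + A + (A + A))"
      unfolding add.assoc using Z finA by (intro card_mono set_plus_mono2) (simp_all add: finite_set_plus finZ)
    then have "n\<^sup>2 * card (Z + Z + Z + Z) \<le> n * (n * card (Z + A + (A + A)))"
      using n1 by (simp add: power2_eq_square mult_left_mono)
    also have "\<dots> \<le> n * (2 * M * card (Z + (A + A)))"
      using step[of "A + A"] finA n1 by (intro mult_left_mono) (auto simp: finite_set_plus)
    also have "\<dots> = 2 * M * (n * card (Z + A + A))" by (simp add: add.assoc)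
    also have "\<dots> \<le> 2 * M * (2 * M * card (Z + A))"
      using step[of A] finA M0 by (intro mult_left_mono) auto
    also have "\<dots> \<le> 2 * M * (2 * M * M)"
      using ZM M0 by (intro mult_left_mono) auto
    finally show ?thesis by (simp add: power_def numeral_eq_Suc)
  qed
  have cZ: "card Z \<le> card A" using Z finA by (intro card_mono)
  then have "(card Z)\<^sup>2 \<le> (card A)\<^sup>2" by (rule power_mono) simp
  then have smallZ: "(card Z)\<^sup>2 < card F" using small by linarith
  have "Z \<noteq> {}" using Z(2) cA by auto
  then have "real (card Z) ^ 10 \<le> 2 ^ 18 * harm (card Z) ^ 3 * M ^ 8 * card (Z + Z + Z + Z)"
    using Z A smallZ ZM by (intro sum_product_bound) auto
  also have "\<dots> \<le> 2 ^ 18 * harm (card A) ^ 3 * M ^ 8 * card (Z + Z + Z + Z)"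
    using M0 cZ by (intro mult_right_mono mult_left_mono power_mono harm_mono harm_nonneg) auto
  finally have b: "real (card Z) ^ 10 \<le> 2 ^ 18 * harm (card A) ^ 3 * M ^ 8 * card (Z + Z + Z + Z)" .
  \<comment> \<open>The constant collects \<open>2 ^ 10\<close> from halving, \<open>2 ^ 18\<close>
    from \<open>b\<close> and 4 from \<open>four\<close>.\<close>
  have "n \<le> 2 * real (card Z)" using Z(2) by (simp add: n_def)
  then have "n ^ 10 \<le> (2 * real (card Z)) ^ 10" using n1 by (intro power_mono) auto
  then have "n\<^sup>2 * n ^ 10 \<le> n\<^sup>2 * (2 * real (card Z)) ^ 10" by (intro mult_left_mono) auto
  also have "\<dots> = n\<^sup>2 * (2 ^ 10 * real (card Z) ^ 10)" by (simp add: power_mult_distrib)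
  also have "\<dots> \<le> n\<^sup>2 * (2 ^ 10 * (2 ^ 18 * harm (card A) ^ 3 * M ^ 8 * card (Z + Z + Z + Z)))"
    using b by (intro mult_left_mono) auto
  also have "\<dots> = 2 ^ 28 * harm (card A) ^ 3 * M ^ 8 * (n\<^sup>2 * card (Z + Z + Z + Z))"
    by simp
  also have "\<dots> \<le> 2 ^ 28 * harm (card A) ^ 3 * M ^ 8 * (4 * M ^ 3)"
    using four M0 by (intro mult_left_mono) (auto simp: harm_nonneg)
  also have "\<dots> = 2 ^ 30 * harm (card A) ^ 3 * M ^ 11"
    by (simp add: power_def numeral_eq_Suc)
  finally show ?thesis by (simp add: n_def M_def flip: power_add)
qed

end

section \<open>The prime fields inside a single ring\<close>

text \<open>
  The product of all rings of integers modulo \<open>n\<close>. It contains the field with \<open>p\<close> elements, for every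
  prime \<open>p\<close>, as the elements supported at the coordinate \<open>p\<close>.
\<close>

quotient_type residues = "nat \<Rightarrow> int" / "\<lambda>f g. \<forall>n. [f n = g n] (mod int n)"
  by (intro equivpI reflpI sympI transpI) (auto intro: cong_sym cong_trans)

instantiation residues :: comm_ring_1
begin

lift_definition zero_residues :: residues is "\<lambda>_. 0" .

lift_definition one_residues :: residues is "\<lambda>_. 1" .

lift_definition plus_residues :: "residues \<Rightarrow> residues \<Rightarrow> residues" is "\<lambda>f g n. f n + g n"
  by (simp add: cong_add)

lift_definition minus_residues :: "residues \<Rightarrow> residues \<Rightarrow> residues" is "\<lambda>f g n. f n - g n"
  by (simp add: cong_diff)

lift_definition uminus_residues :: "residues \<Rightarrow> residues" is "\<lambda>f n. - f n"
  by (simp add: cong_minus_minus_iff)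

lift_definition times_residues :: "residues \<Rightarrow> residues \<Rightarrow> residues" is "\<lambda>f g n. f n * g n"
  by (simp add: cong_mult)

instance
proof
  \<comment> \<open>Congruence modulo 0 is equality, so coordinate 0 separates 0 from 1.\<close>
  show "(0::residues) \<noteq> 1"
    by transfer (auto simp: cong_def intro!: exI[of _ 0])
qed (transfer; simp add: algebra_simps)+

end

text \<open>For each \<open>p\<close> this map in \<open>x\<close> is additive and multiplicative
  with kernel the multiples of \<open>p\<close>; it sends 1 to the idempotent that serves as the
  unit \<open>e\<close>.\<close>

lift_definition residue_at :: "nat \<Rightarrow> int \<Rightarrow> residues" is "\<lambda>p x n. if n = p then x else 0" .

lemma residue_at_add: "residue_at p (x + y) = residue_at p x + residue_at p y"
  by transfer simp

lemma residue_at_diff: "residue_at p (x - y) = residue_at p x - residue_at p y"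
  by transfer simp

lemma residue_at_mult: "residue_at p (x * y) = residue_at p x * residue_at p y"
  by transfer simp

lemma residue_at_of_nat: "residue_at p (int k) = of_nat k * residue_at p 1"
proof (induction k)
  case 0
  show ?case by (simp, transfer) simp
qed (simp add: residue_at_add algebra_simps)

lemma residue_at_eq_iff: "residue_at p x = residue_at p y \<longleftrightarrow> [x = y] (mod int p)"
  by transfer auto

lemma residue_at_mod: "residue_at p (x mod int p) = residue_at p x"
  by (simp add: residue_at_eq_iff)

lemma residue_at_eq_0_iff: "residue_at p x = 0 \<longleftrightarrow> int p dvd x"
proof -
  have "residue_at p 0 = 0" by transfer simp
  then show ?thesis using residue_at_eq_iff[of p x 0] by (simp add: cong_0_iff)
qed

lemma inj_on_residue_at: "inj_on (residue_at p) {0..<int p}"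
  by (auto simp: inj_on_def residue_at_eq_iff cong_def)

lemma range_residue_at:
  assumes "p > 0"
  shows "range (residue_at p) = residue_at p ` {0..<int p}"
proof
  show "range (residue_at p) \<subseteq> residue_at p ` {0..<int p}"
  proof clarify
    fix x
    have "x mod int p \<in> {0..<int p}" using assms by simp
    then show "residue_at p x \<in> residue_at p ` {0..<int p}"
      using residue_at_mod[of p x] by (metis imageI)
  qed
qed auto

text \<open>Euclid's lemma excludes zero divisors, and every element is the image of a natural
  number, hence a multiple of the unit.\<close>

lemma finite_prime_field_residue_at:
  assumes "prime p"
  shows "finite_prime_field (range (residue_at p)) (residue_at p 1)"
proof
  have p: "p > 0" using assms prime_gt_0_nat by blast
  show "finite (range (residue_at p))" using range_residue_at[OF p] by simp
  show "\<exists>k. x = of_nat k * residue_at p 1" if x: "x \<in> range (residue_at p)" for x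
  proof -
    obtain y where "y \<in> {0..<int p}" "x = residue_at p y" using x range_residue_at[OF p] by auto
    then show ?thesis using residue_at_of_nat[of p "nat y"] by (intro exI[of _ "nat y"]) simp
  qed
  show "x = 0 \<or> y = 0"
    if "x \<in> range (residue_at p)" "y \<in> range (residue_at p)" "x * y = 0" for x y
    using that assms
    by (auto simp: residue_at_eq_0_iff prime_dvd_mult_iff simp flip: residue_at_mult)
qed (auto simp flip: residue_at_mult residue_at_diff)

lemma card_image_residue_at:
  assumes "p > 0" "S \<subseteq> {0..<int p}"
  shows "card (residue_at p ` S) = card S"
  using card_image inj_on_subset[OF inj_on_residue_at assms(2)] by blast

section \<open>Sum and product sets of \<open>residue_ring\<close>\<close>

lemma set_add_residue_ring:
  "A <+>\<^bsub>residue_ring m\<^esub> B = (\<lambda>(x, y). (x + y) mod m) ` (A \<times> B)"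
  by (auto simp: set_add_def set_mult_def residue_ring_def)

lemma set_mult_residue_ring:
  "A <#>\<^bsub>residue_ring m\<^esub> B = (\<lambda>(x, y). (x * y) mod m) ` (A \<times> B)"
  by (auto simp: set_mult_def residue_ring_def)

text \<open>\<open>residue_at p\<close> does not see reduction modulo \<open>p\<close>, so it maps
  one sumset onto the other, and it is injective on the representatives from 0 to
  \<open>p - 1\<close>.\<close>

lemma card_set_add_residue_ring:
  assumes "p > 0"
  shows "card (A <+>\<^bsub>residue_ring (int p)\<^esub> A) = card (residue_at p ` A + residue_at p ` A)"
proof -
  have "residue_at p ` (A <+>\<^bsub>residue_ring (int p)\<^esub> A) = residue_at p ` A + residue_at p ` A"
    unfolding set_add_residue_ring set_plus_image
    by (force simp: residue_at_mod residue_at_add image_iff)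
  moreover have "A <+>\<^bsub>residue_ring (int p)\<^esub> A \<subseteq> {0..<int p}"
    using assms by (auto simp: set_add_residue_ring)
  ultimately show ?thesis using card_image_residue_at[OF assms] by metis
qed

lemma card_set_mult_residue_ring:
  assumes "p > 0"
  shows "card (A <#>\<^bsub>residue_ring (int p)\<^esub> A) = card (residue_at p ` A * residue_at p ` A)"
proof -
  have "residue_at p ` (A <#>\<^bsub>residue_ring (int p)\<^esub> A) = residue_at p ` A * residue_at p ` A"
    unfolding set_mult_residue_ring set_times_image
    by (force simp: residue_at_mod residue_at_mult image_iff)
  moreover have "A <#>\<^bsub>residue_ring (int p)\<^esub> A \<subseteq> {0..<int p}"
    using assms by (auto simp: set_mult_residue_ring)
  ultimately show ?thesis using card_image_residue_at[OF assms] by metis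
qed

lemma Units_residue_ring_prime:
  assumes "prime p"
  shows "Units (residue_ring (int p)) \<subseteq> {1..<int p}"
proof -
  interpret residues_prime p "residue_ring (int p)"
    using assms by unfold_locales auto
  show ?thesis using res_prime_units_eq by auto
qed

section \<open>Logarithms and the final estimate\<close>

lemma half_le_ln:
  fixes x :: real
  assumes "x \<ge> 2"
  shows "1 / 2 \<le> ln x"
proof -
  have "1 / 2 \<le> ln (2::real)" using ln_le_minus_one[of "1 / 2 :: real"] by (simp add: ln_div)
  also have "\<dots> \<le> ln x" using assms by simp
  finally show ?thesis .
qed

text \<open>\<open>harm n - ln n\<close> decreases, so it is at most its value 1 at
  \<open>n = 1\<close>, and \<open>2 * ln n\<close> absorbs this 1.\<close>

lemma harm_le_ln:
  assumes "n \<ge> 2"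
  shows "harm n \<le> 3 * ln (real n)"
proof -
  have "harm n - ln (real n) \<le> (harm 1 - ln (real 1) :: real)"
  proof -
    have "decseq (\<lambda>n. harm (Suc n) - ln (real (Suc n)) :: real)"
      using decseq_harm_diff_ln by simp
    from decseqD[OF this, of 0 "n - 1"] show ?thesis using assms by simp
  qed
  moreover have "1 / 2 \<le> ln (real n)" using assms by (intro half_le_ln) simp
  ultimately show ?thesis by (simp add: harm_def)
qed

theorem theorem1:
  shows "\<exists>c::real. \<exists>p\<^sub>0::nat. c > 0 \<and>
    (\<forall>(p::nat) (A::int set).
      p > p\<^sub>0 \<longrightarrow> prime p \<longrightarrow>
      A \<subseteq> Units (residue_ring (int p)) \<longrightarrow>
      2 \<le> card A \<longrightarrow> real (card A) < sqrt (real p) \<longrightarrow>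
      real (max (card (A <#>\<^bsub>residue_ring (int p)\<^esub> A))
                (card (A <+>\<^bsub>residue_ring (int p)\<^esub> A)))
        \<ge> c * real (card A) powr (1 + 1 / 11) * (1 / ln (real (card A)) powr (4 / 11)))"
proof (intro exI[of _ "1 / 2 powr (36 / 11)"] exI[of _ 0] conjI allI impI)
  fix p :: nat and A :: "int set"
  assume p: "prime p" and A: "A \<subseteq> Units (residue_ring (int p))" "2 \<le> card A"
    and small: "real (card A) < sqrt (real p)"
  interpret finite_prime_field "range (residue_at p)" "residue_at p 1"
    by (rule finite_prime_field_residue_at[OF p])
  define n where "n = real (card A)"
  define M where "M = real (max (card (A <#>\<^bsub>residue_ring (int p)\<^esub> A)) (card (A <+>\<^bsub>residue_ring (int p)\<^esub> A)))"
  define l where "l = ln n"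
  have p0: "p > 0" using p prime_gt_0_nat by blast
  have A1: "A \<subseteq> {1..<int p}" using A Units_residue_ring_prime[OF p] by blast
  then have A0: "A \<subseteq> {0..<int p}" by force
  have cA: "card (residue_at p ` A) = card A" by (rule card_image_residue_at[OF p0 A0])
  have "0 \<notin> residue_at p ` A"
  proof
    assume "0 \<in> residue_at p ` A"
    then obtain x where "x \<in> A" "int p dvd x" by (metis imageE residue_at_eq_0_iff)
    then show False using A1 zdvd_imp_le[of "int p" x] by force
  qed
  moreover have "(card (residue_at p ` A))\<^sup>2 < card (range (residue_at p))"
  proof -
    have "n\<^sup>2 < (sqrt p)\<^sup>2" using small by (intro power_strict_mono) (auto simp: n_def)
    then have "(card A)\<^sup>2 < p" by (simp add: n_def flip: of_nat_power)
    then show ?thesis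
      using card_image_residue_at[OF p0, of "{0..<int p}"] cA by (simp add: range_residue_at[OF p0])
  qed
  moreover have "residue_at p ` A \<noteq> {}" using A(2) by auto
  ultimately have "n ^ 12 \<le> 2 ^ 30 * harm (card A) ^ 3 * M ^ 11"
    using sum_product[of "residue_at p ` A", OF image_mono[OF subset_UNIV]]
    unfolding cA card_set_add_residue_ring[OF p0, symmetric] card_set_mult_residue_ring[OF p0, symmetric]
    by (simp add: n_def M_def)
  also have "\<dots> \<le> 2 ^ 36 * l ^ 4 * M ^ 11"
  proof (rule mult_right_mono)
    \<comment> \<open>The factor \<open>2 * l \<ge> 1\<close> raises \<open>l ^ 3\<close> to
      \<open>l ^ 4\<close>, whence the exponent 4/11; the constants fit because
      \<open>27 * 2 \<le> 2 ^ 6\<close>.\<close>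
    have l: "1 \<le> 2 * l" using half_le_ln[of n] A(2) by (simp add: l_def n_def)
    have "harm (card A) ^ 3 \<le> (3 * l) ^ 3"
      using harm_le_ln[OF A(2)] by (intro power_mono) (auto simp: l_def n_def harm_nonneg)
    also have "\<dots> \<le> (3 * l) ^ 3 * (2 * l)"
      using l mult_left_mono[of 1 "2 * l" "(3 * l) ^ 3"] by simp
    also have "\<dots> \<le> 2 ^ 6 * l ^ 4"
      using l by (simp add: power_mult_distrib power_def numeral_eq_Suc)
    finally show "2 ^ 30 * harm (card A) ^ 3 \<le> 2 ^ 36 * l ^ 4" by simp
  qed (simp add: M_def)
  finally have main: "n ^ 12 \<le> 2 ^ 36 * l ^ 4 * M ^ 11" .
  have n: "n > 1" "l > 0" using A(2) by (auto simp: n_def l_def)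
  have M: "M \<ge> 0" by (simp add: M_def)
  have root: "(x ^ k) powr (1 / 11) = x powr (real k / 11)" if "x > 0" for x :: real and k
    using powr_powr[of x "real k" "1 / 11"] powr_realpow[OF that, of k] by simp
  have "n powr (12 / 11) = (n ^ 12) powr (1 / 11)"
    using root[of n 12] n by simp
  \<comment> \<open>Eleventh roots of \<open>main\<close> give the exponents 12/11 and 4/11 and turn
    \<open>2 ^ 36\<close> into the reciprocal of the chosen \<open>c\<close>.\<close>
  also have "\<dots> \<le> (2 ^ 36 * l ^ 4 * M ^ 11) powr (1 / 11)"
    using main n by (intro powr_mono2) auto
  also have "\<dots> = 2 powr (36 / 11) * l powr (4 / 11) * M"
  proof -
    have "(M ^ 11) powr (1 / 11) = M"
      using M root[of M 11] by (cases "M = 0") auto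
    moreover have "(l ^ 4) powr (1 / 11) = l powr (4 / 11)"
      using root[of l 4] n by simp
    moreover have "(2 ^ 36 :: real) powr (1 / 11) = 2 powr (36 / 11)"
      using root[of 2 36] by (simp only: of_nat_numeral zero_less_numeral simp_thms)
    ultimately show ?thesis using n M by (simp add: powr_mult)
  qed
  finally have "n powr (12 / 11) / (2 powr (36 / 11) * l powr (4 / 11)) \<le> M"
    using n by (simp add: pos_divide_le_eq mult.commute)
  then show "1 / 2 powr (36 / 11) * real (card A) powr (1 + 1 / 11) * (1 / ln (real (card A)) powr (4 / 11))
      \<le> real (max (card (A <#>\<^bsub>residue_ring (int p)\<^esub> A)) (card (A <+>\<^bsub>residue_ring (int p)\<^esub> A)))"
    by (simp add: n_def l_def M_def)
qed simp

end
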